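(* Let $T$ be a c.n.u. contraction on $H$ and $\mathcal{B}_T=A_T^{\perp_s}/A_T$ with its quotient strong symplectic structure. For $\lambda\in\mathbb{D}_+\cup\mathbb{D}_-$ let $W_T(\lambda)$ be the image of $N_\lambda$ under the quotient map $A_T^{\perp_s}\to\mathcal{B}_T$. Then $W_T(\lambda)\in W_+(\mathcal{B}_T)$ for $\lambda\in\mathbb{D}_+$, $W_T(\lambda)\in W_-(\mathcal{B}_T)$ for $\lambda\in\mathbb{D}_-$, the map $W_T:\mathbb{D}_+\cup\mathbb{D}_-\to W_+(\mathcal{B}_T)\cup W_-(\mathcal{B}_T)$ is holomorphic, and $W_T(\bar\lambda)=(W_T(\lambda))^{\perp_s}$ for every $\lambda\in\mathbb{D}_+$, where $\bar\lambda$ is regarded as a point of $\mathbb{D}_-$.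
   Context: $H$ is an infinite-dimensional separable complex Hilbert space; $T\in\mathbb{B}(H)$, $\|T\|\le1$, is completely non-unitary (no nonzero invariant subspace on which $T$ is unitary). $\mathbb{K}=\ker(I-T^*T)$. $\mathbb{H}=H\oplus_\perp H$ with $[(x_1,x_2),(y_1,y_2)]=i(x_1,y_1)_H-i(x_2,y_2)_H$; $S^{\perp_s}=\{a:[a,b]=0\ \forall b\in S\}$; $A_T=\{(x,Tx):x\in\mathbb{K}\}$, which is isotropic. The quotient $A_T^{\perp_s}/A_T$ carries the quotient Hilbert structure and the strong symplectic form $[[x],[y]]=[x,y]$. $\mathbb{D}_+$ and $\mathbb{D}_-$ are two copies of the open unit disc; $\mathbb{D}_-$ is identified with $(\mathbb{C}\setminus\overline{\mathbb{D}})\cup\{\infty\}$ via $\lambda\mapsto1/\lambda$. For $\lambda\in\mathbb{D}_\pm$, $\bar\lambda$ (complex conjugate of the coordinate) is regarded as a point of $\mathbb{D}_\mp$. Define $N_\lambda=\{(x,\lambda x):x\in H\}\cap A_T^{\perp_s}$ for $\lambda\in\mathbb{D}_+$ and $N_\lambda=\{(\lambda x,x):x\in H\}\cap A_T^{\perp_s}$ for $\lambda\in\mathbb{D}_-$. For a strong symplectic Hilbert space $\mathcal{B}$, $W_+(\mathcal{B})$ (resp. $W_-(\mathcal{B})$) is the set of maximally completely positive- (resp. negative-) definite subspaces: closed subspaces $L$, maximal with $-i[x,x]>0$ (resp. $i[x,x]>0$) for $x\ne0$, and with $\pm(-i[x,x])\ge c\|x\|^2$ on $L$ for some $c>0$.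 Complex structure: fixing $L\in W_+(\mathcal{B})$ (so $\mathcal{B}=L\oplus L^{\perp_s}$), each $W\in W_+(\mathcal{B})$ is uniquely $\{x+Cx:x\in L\}$ with $C\in\mathbb{B}(L,L^{\perp_s})$, $\|C\|<1$ (norms from $-i[\cdot,\cdot]$ on $L$ and $i[\cdot,\cdot]$ on $L^{\perp_s}$), and each $W\in W_-(\mathcal{B})$ is uniquely $\{Dy+y:y\in L^{\perp_s}\}$ with $D\in\mathbb{B}(L^{\perp_s},L)$, $\|D\|<1$; a map into $W_\pm(\mathcal{B})$ is holomorphic if these operator parameters depend holomorphically on the variable. *)

theory Defs
  imports "HOL-Analysis.Analysis"
begin

class complex_inner = real_normed_vector +
  fixes cscale :: "complex \<Rightarrow> 'a \<Rightarrow> 'a"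
    and cinner :: "'a \<Rightarrow> 'a \<Rightarrow> complex"
  assumes cscale_add_right: "cscale a (x + y) = cscale a x + cscale a y"
    and cscale_add_left: "cscale (a + b) x = cscale a x + cscale b x"
    and cscale_cscale: "cscale a (cscale b x) = cscale (a * b) x"
    and cscale_one: "cscale 1 x = x"
    and scaleR_cscale: "scaleR r x = cscale (complex_of_real r) x"
    and cinner_cnj: "cinner x y = cnj (cinner y x)"
    and cinner_add_left: "cinner (x + y) z = cinner x z + cinner y z"
    and cinner_cscale_left: "cinner (cscale a x) y = a * cinner x y"
    and cinner_norm: "cinner x x = complex_of_real ((norm x)\<^sup>2)"

class chilbert = complex_inner + complete_space

definition clinear :: "('a::complex_inner \<Rightarrow> 'b::complex_inner) \<Rightarrow> bool" where
  "clinear f \<longleftrightarrow> (\<forall>x y. f (x + y) = f x + f y) \<and> (\<forall>c x. f (cscale c x) = cscale c (f x))"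

definition bounded_clinear :: "('a::complex_inner \<Rightarrow> 'b::complex_inner) \<Rightarrow> bool" where
  "bounded_clinear f \<longleftrightarrow> clinear f \<and> (\<exists>K. \<forall>x. norm (f x) \<le> norm x * K)"

definition cadjoint :: "('a::complex_inner \<Rightarrow> 'a) \<Rightarrow> 'a \<Rightarrow> 'a" where
  "cadjoint T y = (THE z. \<forall>x. cinner (T x) y = cinner x z)"

definition cspan :: "'a::complex_inner set \<Rightarrow> 'a set" where
  "cspan S = {x. \<exists>F c. finite F \<and> F \<subseteq> S \<and> x = (\<Sum>v\<in>F. cscale (c v) v)}"

definition csubspace :: "'a::complex_inner set \<Rightarrow> bool" where
  "csubspace M \<longleftrightarrow> 0 \<in> M \<and> (\<forall>x\<in>M. \<forall>y\<in>M. x + y \<in> M) \<and> (\<forall>c. \<forall>x\<in>M. cscale c x \<in> M)"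

definition closed_csubspace :: "'a::complex_inner set \<Rightarrow> bool" where
  "closed_csubspace M \<longleftrightarrow> csubspace M \<and> closed M"

definition cnu :: "('a::complex_inner \<Rightarrow> 'a) \<Rightarrow> bool" where
  "cnu T \<longleftrightarrow> (\<forall>M. closed_csubspace M \<and> T ` M = M \<and> (\<forall>x\<in>M. norm (T x) = norm x) \<longrightarrow> M = {0})"

definition defectK :: "('a::complex_inner \<Rightarrow> 'a) \<Rightarrow> 'a set" where
  "defectK T = {x. x - cadjoint T (T x) = 0}"

text \<open>Elements of \<open>\<bbbH>\<close> are pairs; the product type carries the Hilbert direct-sum norm
\<open>sqrt (\<parallel>x\<^sub>1\<parallel>\<^sup>2 + \<parallel>x\<^sub>2\<parallel>\<^sup>2)\<close> from the library.\<close>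

definition pscale :: "complex \<Rightarrow> ('a::complex_inner \<times> 'a) \<Rightarrow> 'a \<times> 'a" where
  "pscale c a = (cscale c (fst a), cscale c (snd a))"

definition symp :: "('a::complex_inner \<times> 'a) \<Rightarrow> 'a \<times> 'a \<Rightarrow> complex" where
  "symp a b = \<i> * cinner (fst a) (fst b) - \<i> * cinner (snd a) (snd b)"

definition sperp :: "('a::complex_inner \<times> 'a) set \<Rightarrow> ('a \<times> 'a) set" where
  "sperp S = {a. \<forall>b\<in>S. symp a b = 0}"

definition AT :: "('a::complex_inner \<Rightarrow> 'a) \<Rightarrow> ('a \<times> 'a) set" where
  "AT T = (\<lambda>x. (x, T x)) ` defectK T"

text \<open>\<open>N\<^sub>\<lambda>\<close> for \<open>\<lambda> \<in> \<bbbD>\<^sub>+\<close> (coordinate \<open>\<lambda>\<close>) and for \<open>\<lambda> \<in> \<bbbD>\<^sub>-\<close> (disc coordinate \<open>\<lambda>\<close>).\<close>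
definition Nplus :: "('a::complex_inner \<Rightarrow> 'a) \<Rightarrow> complex \<Rightarrow> ('a \<times> 'a) set" where
  "Nplus T z = {(x, cscale z x) | x. True} \<inter> sperp (AT T)"

definition Nminus :: "('a::complex_inner \<Rightarrow> 'a) \<Rightarrow> complex \<Rightarrow> ('a \<times> 'a) set" where
  "Nminus T z = {(cscale z x, x) | x. True} \<inter> sperp (AT T)"

definition qcls :: "('a::complex_inner \<times> 'a) set \<Rightarrow> 'a \<times> 'a \<Rightarrow> ('a \<times> 'a) set" where
  "qcls A x = (\<lambda>a. x + a) ` A"

definition qspace :: "('a::complex_inner \<times> 'a) set \<Rightarrow> ('a \<times> 'a) set set" where
  "qspace A = qcls A ` sperp A"

definition qrep :: "('a \<times> 'a) set \<Rightarrow> 'a \<times> 'a" where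
  "qrep \<xi> = (SOME x. x \<in> \<xi>)"

definition qadd :: "('a::complex_inner \<times> 'a) set \<Rightarrow> ('a \<times> 'a) set \<Rightarrow> ('a \<times> 'a) set \<Rightarrow> ('a \<times> 'a) set" where
  "qadd A \<xi> \<eta> = qcls A (qrep \<xi> + qrep \<eta>)"

definition qscale :: "('a::complex_inner \<times> 'a) set \<Rightarrow> complex \<Rightarrow> ('a \<times> 'a) set \<Rightarrow> ('a \<times> 'a) set" where
  "qscale A c \<xi> = qcls A (pscale c (qrep \<xi>))"

definition qdiff :: "('a::complex_inner \<times> 'a) set \<Rightarrow> ('a \<times> 'a) set \<Rightarrow> ('a \<times> 'a) set \<Rightarrow> ('a \<times> 'a) set" where
  "qdiff A \<xi> \<eta> = qadd A \<xi> (qscale A (-1) \<eta>)"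

definition qnorm :: "('a::complex_inner \<times> 'a) set \<Rightarrow> real" where
  "qnorm \<xi> = (INF y\<in>\<xi>. norm y)"

definition qsymp :: "('a::complex_inner \<times> 'a) set \<Rightarrow> ('a \<times> 'a) set \<Rightarrow> complex" where
  "qsymp \<xi> \<eta> = symp (qrep \<xi>) (qrep \<eta>)"

definition qperp :: "('a::complex_inner \<times> 'a) set \<Rightarrow> ('a \<times> 'a) set set \<Rightarrow> ('a \<times> 'a) set set" where
  "qperp A S = {\<eta> \<in> qspace A. \<forall>\<xi>\<in>S. qsymp \<eta> \<xi> = 0}"

definition qsubspace :: "('a::complex_inner \<times> 'a) set \<Rightarrow> ('a \<times> 'a) set set \<Rightarrow> bool" where
  "qsubspace A S \<longleftrightarrow> S \<subseteq> qspace A \<and> A \<in> S \<and>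
     (\<forall>\<xi>\<in>S. \<forall>\<eta>\<in>S. qadd A \<xi> \<eta> \<in> S) \<and> (\<forall>c. \<forall>\<xi>\<in>S. qscale A c \<xi> \<in> S)"

definition qclosed :: "('a::complex_inner \<times> 'a) set \<Rightarrow> ('a \<times> 'a) set set \<Rightarrow> bool" where
  "qclosed A S \<longleftrightarrow> (\<forall>f \<xi>. (\<forall>n. f n \<in> S) \<and> \<xi> \<in> qspace A \<and>
      (\<lambda>n. qnorm (qdiff A (f n) \<xi>)) \<longlonglongrightarrow> 0 \<longrightarrow> \<xi> \<in> S)"

text \<open>\<open>-i[x,x]\<close> (which is real) and \<open>i[x,x]\<close> on the quotient.\<close>
definition qpos :: "('a::complex_inner \<times> 'a) set \<Rightarrow> real" where
  "qpos \<xi> = Re (- \<i> * qsymp \<xi> \<xi>)"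

definition qneg :: "('a::complex_inner \<times> 'a) set \<Rightarrow> real" where
  "qneg \<xi> = Re (\<i> * qsymp \<xi> \<xi>)"

definition Wplus :: "('a::complex_inner \<times> 'a) set \<Rightarrow> ('a \<times> 'a) set set set" where
  "Wplus A = {L. qsubspace A L \<and> qclosed A L \<and> (\<forall>\<xi>\<in>L. \<xi> \<noteq> A \<longrightarrow> qpos \<xi> > 0) \<and>
      (\<exists>c>0. \<forall>\<xi>\<in>L. qpos \<xi> \<ge> c * (qnorm \<xi>)\<^sup>2) \<and>
      (\<forall>L'. qsubspace A L' \<and> qclosed A L' \<and> (\<forall>\<xi>\<in>L'. \<xi> \<noteq> A \<longrightarrow> qpos \<xi> > 0) \<and> L \<subseteq> L'
          \<longrightarrow> L' = L)}"

definition Wminus :: "('a::complex_inner \<times> 'a) set \<Rightarrow> ('a \<times> 'a) set set set" where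
  "Wminus A = {L. qsubspace A L \<and> qclosed A L \<and> (\<forall>\<xi>\<in>L. \<xi> \<noteq> A \<longrightarrow> qneg \<xi> > 0) \<and>
      (\<exists>c>0. \<forall>\<xi>\<in>L. qneg \<xi> \<ge> c * (qnorm \<xi>)\<^sup>2) \<and>
      (\<forall>L'. qsubspace A L' \<and> qclosed A L' \<and> (\<forall>\<xi>\<in>L'. \<xi> \<noteq> A \<longrightarrow> qneg \<xi> > 0) \<and> L \<subseteq> L'
          \<longrightarrow> L' = L)}"

text \<open>Bounded complex-linear map \<open>C : X \<rightarrow> Y\<close> between subspaces of the quotient, with
operator norm \<open>< 1\<close> w.r.t. the norms \<open>nX\<close> on \<open>X\<close> and \<open>nY\<close> on \<open>Y\<close>
(the norms are square roots of the given nonnegative quadratic forms).\<close>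
definition qstrict_contraction ::
  "('a::complex_inner \<times> 'a) set \<Rightarrow> ('a \<times> 'a) set set \<Rightarrow> ('a \<times> 'a) set set \<Rightarrow>
   (('a \<times> 'a) set \<Rightarrow> real) \<Rightarrow> (('a \<times> 'a) set \<Rightarrow> real) \<Rightarrow>
   (('a \<times> 'a) set \<Rightarrow> ('a \<times> 'a) set) \<Rightarrow> bool" where
  "qstrict_contraction A X Y qX qY C \<longleftrightarrow>
     (\<forall>\<xi>\<in>X. C \<xi> \<in> Y) \<and>
     (\<forall>\<xi>\<in>X. \<forall>\<eta>\<in>X. C (qadd A \<xi> \<eta>) = qadd A (C \<xi>) (C \<eta>)) \<and>
     (\<forall>c. \<forall>\<xi>\<in>X. C (qscale A c \<xi>) = qscale A c (C \<xi>)) \<and>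
     (\<exists>k<1. \<forall>\<xi>\<in>X. sqrt (qY (C \<xi>)) \<le> k * sqrt (qX \<xi>))"

text \<open>Holomorphic dependence (in operator norm) of a family \<open>F z : X \<rightarrow> quotient\<close> on \<open>z \<in> U\<close>:
complex differentiability, with a derivative \<open>D\<close>, uniformly on the unit ball.\<close>
definition qholo ::
  "('a::complex_inner \<times> 'a) set \<Rightarrow> ('a \<times> 'a) set set \<Rightarrow>
   (complex \<Rightarrow> ('a \<times> 'a) set \<Rightarrow> ('a \<times> 'a) set) \<Rightarrow> complex set \<Rightarrow> bool" where
  "qholo A X F U \<longleftrightarrow> (\<forall>z0\<in>U. \<exists>D. (\<forall>\<xi>\<in>X. D \<xi> \<in> qspace A) \<and>
     (\<forall>\<epsilon>>0. \<exists>\<delta>>0. \<forall>z\<in>U. 0 < cmod (z - z0) \<and> cmod (z - z0) < \<delta> \<longrightarrow>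
        (\<forall>\<xi>\<in>X. qnorm (qdiff A (qdiff A (F z \<xi>) (F z0 \<xi>)) (qscale A (z - z0) (D \<xi>)))
                 \<le> \<epsilon> * cmod (z - z0) * qnorm \<xi>)))"

definition holo_Wplus :: "('a::complex_inner \<times> 'a) set \<Rightarrow> (complex \<Rightarrow> ('a \<times> 'a) set set) \<Rightarrow> complex set \<Rightarrow> bool" where
  "holo_Wplus A W U \<longleftrightarrow> (\<forall>L\<in>Wplus A. \<exists>C.
      (\<forall>z\<in>U. qstrict_contraction A L (qperp A L) qpos qneg (C z) \<and>
               W z = {qadd A \<xi> (C z \<xi>) | \<xi>. \<xi> \<in> L}) \<and>
      qholo A L C U)"

definition holo_Wminus :: "('a::complex_inner \<times> 'a) set \<Rightarrow> (complex \<Rightarrow> ('a \<times> 'a) set set) \<Rightarrow> complex set \<Rightarrow> bool" where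
  "holo_Wminus A W U \<longleftrightarrow> (\<forall>L\<in>Wplus A. \<exists>D.
      (\<forall>z\<in>U. qstrict_contraction A (qperp A L) L qneg qpos (D z) \<and>
               W z = {qadd A (D z \<eta>) \<eta> | \<eta>. \<eta> \<in> qperp A L}) \<and>
      qholo A (qperp A L) D U)"

definition WTplus :: "('a::complex_inner \<Rightarrow> 'a) \<Rightarrow> complex \<Rightarrow> ('a \<times> 'a) set set" where
  "WTplus T z = qcls (AT T) ` Nplus T z"

definition WTminus :: "('a::complex_inner \<Rightarrow> 'a) \<Rightarrow> complex \<Rightarrow> ('a \<times> 'a) set set" where
  "WTminus T z = qcls (AT T) ` Nminus T z"

end

(* A closed isotropic subspace A of H + H is all that is used of A_T. The Moebius transformation
   attached to z moves the planes {(x, z x)} and {(cnj z y, y)} to the coordinate planes, where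
   reduction by A is an orthogonal projection; this yields the splitting
   A^perp = N_z + N_(cnj z) + A and with it definiteness, maximality and the duality.
   A subspace L in W_+ lifts to the graph of a contraction S on all of H (otherwise L could be
   enlarged), and its complement lifts to {(R b, b)} with R the adjoint of S. In these coordinates
   the point (x, z x) of N_z over (y, S y) is given by x = (1 - z R)^(-1) (y - R S y), so holomorphy
   is that of the resolvent. W_- is the same statement with the two coordinates, S and R swapped. *)

theory Submission
  imports Defs
begin

section \<open>Complex inner product spaces\<close>

text \<open>The obstacle is that \<open>S\<close> is isometric on the first coordinates of
  \<open>A\<close>, where \<open>R\<close> inverts it. Unless \<open>A\<close> is trivial, 1 - R S
  has a kernel and S has no norm bound below 1 on all of H; the uniform positivity in
  \<open>Wplus\<close>, measured in the quotient norm, becomes a strict bound only for y orthogonal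
  to those coordinates. Strictness is used only there: R S is self-adjoint and fixes these
  coordinates, so it preserves their orthogonal complement, and a fixed point argument inverts 1 - R
  S on it. The resolvent needs only norm at most 1, which R has everywhere. Hence the operator
  parameter is built on pairs rather than on classes: it is minus the identity on \<open>A\<close>,
  so it descends, and an estimate valid for every representative passes to the quotient norm, an
  infimum over representatives. Since \<open>holo_Wplus\<close> and \<open>holo_Wminus\<close> range
  over every base point \<open>L\<close>, S and R are extracted from an arbitrary \<open>L\<close>.
  Since \<open>qholo\<close> asks for a derivative uniform on the unit ball, the Taylor remainder is
  bounded with explicit constants.\<close>

lemma cscale_zero_left [simp]: "cscale 0 (x::'a::complex_inner) = 0"
  using cscale_add_left[of 0 0 x] by simp

lemma cscale_zero_right [simp]: "cscale a (0::'a::complex_inner) = 0"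
  using cscale_add_right[of a 0 "0::'a"] by simp

lemma cscale_minus_left [simp]: "cscale (- a) (x::'a::complex_inner) = - cscale a x"
  using cscale_add_left[of a "- a" x] by (simp add: eq_neg_iff_add_eq_0 add.commute)

lemma cscale_minus_right [simp]: "cscale a (- x::'a::complex_inner) = - cscale a x"
  using cscale_add_right[of a x "- x"] by (simp add: eq_neg_iff_add_eq_0 add.commute)

lemma cscale_diff_left: "cscale (a - b) (x::'a::complex_inner) = cscale a x - cscale b x"
  using cscale_add_left[of a "- b" x] by simp

lemma cscale_diff_right: "cscale a (x - y::'a::complex_inner) = cscale a x - cscale a y"
  using cscale_add_right[of a x "- y"] by simp

lemmas cscale_simps = cscale_add_left cscale_add_right cscale_diff_left cscale_diff_right
  cscale_cscale cscale_one

lemma cinner_add_right: "cinner (x::'a::complex_inner) (y + z) = cinner x y + cinner x z"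
  by (metis cinner_add_left cinner_cnj complex_cnj_add)

lemma cinner_cscale_right: "cinner (x::'a::complex_inner) (cscale a y) = cnj a * cinner x y"
  by (metis cinner_cscale_left cinner_cnj complex_cnj_mult)

lemma cinner_zero_left [simp]: "cinner (0::'a::complex_inner) y = 0"
  using cinner_add_left[of "0::'a" 0 y] by simp

lemma cinner_zero_right [simp]: "cinner (x::'a::complex_inner) 0 = 0"
  using cinner_add_right[of x 0 0] by simp

lemma cinner_minus_left [simp]: "cinner (- x::'a::complex_inner) y = - cinner x y"
  using cinner_add_left[of x "- x" y] by (simp add: eq_neg_iff_add_eq_0 add.commute)

lemma cinner_minus_right [simp]: "cinner (x::'a::complex_inner) (- y) = - cinner x y"
  using cinner_add_right[of x y "- y"] by (simp add: eq_neg_iff_add_eq_0 add.commute)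

lemma cinner_diff_left: "cinner (x - y::'a::complex_inner) z = cinner x z - cinner y z"
  using cinner_add_left[of x "- y" z] by simp

lemma cinner_diff_right: "cinner (x::'a::complex_inner) (y - z) = cinner x y - cinner x z"
  using cinner_add_right[of x y "- z"] by simp

lemmas cinner_simps = cinner_add_left cinner_add_right cinner_diff_left cinner_diff_right
  cinner_cscale_left cinner_cscale_right

lemma Re_cinner_self: "Re (cinner x x) = (norm (x::'a::complex_inner))\<^sup>2"
  by (simp add: cinner_norm)

lemma cinner_self_eq_0 [simp]: "cinner x x = 0 \<longleftrightarrow> (x::'a::complex_inner) = 0"
  by (simp add: cinner_norm)

lemma cinner_eq_0_commute: "cinner x y = 0 \<longleftrightarrow> cinner y (x::'a::complex_inner) = 0"
  by (metis cinner_cnj complex_cnj_zero_iff)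

lemma cinner_ext:
  assumes "\<And>u. cinner u x = cinner u (y::'a::complex_inner)"
  shows "x = y"
proof -
  have "cinner (x - y) (x - y) = 0"
    using assms[of "x - y"] by (simp add: cinner_diff_right)
  then show ?thesis by simp
qed

text \<open>The class axioms relate the norm directly only to real scaling; the complex rule is
  recovered from the inner product.\<close>

lemma norm_cscale: "norm (cscale a (x::'a::complex_inner)) = cmod a * norm x"
proof -
  have "(norm (cscale a x))\<^sup>2 = Re (a * cnj a * cinner x x)"
    by (simp only: Re_cinner_self[symmetric] cinner_cscale_left cinner_cscale_right mult_ac)
  also have "\<dots> = (cmod a * norm x)\<^sup>2"
    by (simp add: cinner_norm complex_mult_cnj cmod_power2 power_mult_distrib
        flip: of_real_mult of_real_add of_real_power)
  finally show ?thesis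
    by (simp add: power2_eq_iff_nonneg)
qed

lemma norm_add_sq:
  "(norm (x + y::'a::complex_inner))\<^sup>2 = (norm x)\<^sup>2 + (norm y)\<^sup>2 + 2 * Re (cinner x y)"
proof -
  have "Re (cinner y x) = Re (cinner x y)"
    by (subst cinner_cnj) simp
  then show ?thesis
    by (simp add: Re_cinner_self[symmetric] cinner_simps)
qed

lemma norm_diff_sq:
  "(norm (x - y::'a::complex_inner))\<^sup>2 = (norm x)\<^sup>2 + (norm y)\<^sup>2 - 2 * Re (cinner x y)"
  using norm_add_sq[of x "- y"] by simp

text \<open>The multiple of \<open>y\<close> subtracted is the one that makes the difference orthogonal to \<open>y\<close>.\<close>

lemma norm_diff_proj_sq:
  assumes "(y::'a::complex_inner) \<noteq> 0"
  shows "(norm (x - cscale (cinner x y / (norm y)\<^sup>2) y))\<^sup>2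
    = (norm x)\<^sup>2 - (cmod (cinner x y))\<^sup>2 / (norm y)\<^sup>2"
proof -
  let ?a = "cinner x y / (norm y)\<^sup>2"
  have 1: "Re (cinner x (cscale ?a y)) = (cmod (cinner x y))\<^sup>2 / (norm y)\<^sup>2"
  proof -
    have "cinner x (cscale ?a y) = complex_of_real ((cmod (cinner x y))\<^sup>2 / (norm y)\<^sup>2)"
      by (simp add: cinner_cscale_right complex_mult_cnj cmod_power2 mult.commute)
    then show ?thesis by simp
  qed
  have 2: "(norm (cscale ?a y))\<^sup>2 = (cmod (cinner x y))\<^sup>2 / (norm y)\<^sup>2"
    using assms
    by (simp add: norm_cscale norm_divide norm_power power_mult_distrib power_divide field_simps)
  show ?thesis
    unfolding norm_diff_sq 1 2 by simp
qed

lemma cinner_Cauchy_Schwarz: "cmod (cinner x y) \<le> norm x * norm (y::'a::complex_inner)"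
proof (cases "y = 0")
  case False
  have "0 \<le> (norm x)\<^sup>2 - (cmod (cinner x y))\<^sup>2 / (norm y)\<^sup>2"
    by (metis norm_diff_proj_sq[OF False] zero_le_power2)
  then have "(cmod (cinner x y))\<^sup>2 \<le> (norm x * norm y)\<^sup>2"
    using False by (simp add: field_simps)
  then show ?thesis
    by (rule power2_le_imp_le) simp
qed simp

lemma bounded_bilinear_cinner:
  "bounded_bilinear (cinner :: 'a::complex_inner \<Rightarrow> 'a \<Rightarrow> complex)"
proof
  show "\<exists>K. \<forall>(x::'a) y. norm (cinner x y) \<le> norm x * norm y * K"
    by (intro exI[of _ 1]) (simp add: cinner_Cauchy_Schwarz)
qed (simp_all add: cinner_simps scaleR_cscale scaleR_conv_of_real)

lemma bounded_bilinear_cscale: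
  "bounded_bilinear (cscale :: complex \<Rightarrow> 'a::complex_inner \<Rightarrow> 'a)"
proof
  show "\<exists>K. \<forall>a (x::'a). norm (cscale a x) \<le> norm a * norm x * K"
    by (intro exI[of _ 1]) (simp add: norm_cscale)
qed (simp_all add: cscale_simps scaleR_cscale scaleR_conv_of_real mult_ac)

lemmas continuous_on_cinner [continuous_intros] =
  bounded_bilinear.continuous_on[OF bounded_bilinear_cinner]

lemmas continuous_on_cscale [continuous_intros] =
  bounded_bilinear.continuous_on[OF bounded_bilinear_cscale]

section \<open>Orthogonal projection, Riesz representation and adjoints\<close>

lemma closed_orthogonal_complement: "closed {x. \<forall>u\<in>E. cinner x u = 0}"
proof -
  have "{x. \<forall>u\<in>E. cinner x u = 0} = (\<Inter>u\<in>E. {x. cinner x u = 0})"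
    by auto
  then show ?thesis
    by (auto intro!: closed_INT closed_Collect_eq continuous_intros)
qed

text \<open>A sequence minimising the distance to \<open>x\<close> is Cauchy by the parallelogram
  law, because midpoints stay in \<open>E\<close>. The limit \<open>e\<close> is a minimiser, and a
  nonzero component of \<open>x - e\<close> along some \<open>u\<close> in \<open>E\<close> could be
  added to \<open>e\<close> to come closer.\<close>

lemma orthogonal_projection:
  fixes E :: "'a::chilbert set"
  assumes E: "csubspace E" "closed E"
  obtains e where "e \<in> E" "\<And>u. u \<in> E \<Longrightarrow> cinner (x - e) u = 0"
proof -
  define d where "d = (INF e\<in>E. (norm (x - e))\<^sup>2)"
  have ne: "E \<noteq> {}"
    using E(1) by (auto simp: csubspace_def)
  have bdd: "bdd_below ((\<lambda>e. (norm (x - e))\<^sup>2) ` E)"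
    by (rule bdd_belowI[of _ 0]) auto
  have d_le: "d \<le> (norm (x - e))\<^sup>2" if "e \<in> E" for e
    unfolding d_def using bdd that by (rule cINF_lower)
  have "\<exists>e\<in>E. (norm (x - e))\<^sup>2 < d + 1 / Suc n" for n
  proof -
    have "(INF e\<in>E. (norm (x - e))\<^sup>2) < d + 1 / Suc n"
      unfolding d_def by simp
    then show ?thesis
      unfolding cINF_less_iff[OF ne bdd] .
  qed
  then obtain f where f: "\<And>n. f n \<in> E" "\<And>n. (norm (x - f n))\<^sup>2 < d + 1 / Suc n"
    by metis
  have dist: "(dist (f m) (f n))\<^sup>2 \<le> 2 / Suc m + 2 / Suc n" for m n
  proof -
    let ?h = "cscale (1/2) (f m + f n)"
    have "?h \<in> E"
      using E(1) f(1) by (simp add: csubspace_def)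
    then have "4 * d \<le> 4 * (norm (x - ?h))\<^sup>2"
      using d_le by simp
    also have "\<dots> = (norm (cscale 2 (x - ?h)))\<^sup>2"
      by (simp add: norm_cscale power_mult_distrib)
    also have "cscale 2 (x - ?h) = (x - f m) + (x - f n)"
      using cscale_add_left[of 1 1 x] by (simp add: cscale_simps)
    finally have "4 * d \<le> (norm ((x - f m) + (x - f n)))\<^sup>2" .
    moreover have "(dist (f m) (f n))\<^sup>2 = (norm ((x - f m) - (x - f n)))\<^sup>2"
      by (simp add: dist_norm norm_minus_commute)
    ultimately show ?thesis
      using f(2)[of m] f(2)[of n] unfolding norm_add_sq norm_diff_sq[of "x - f m"] by simp
  qed
  have "Cauchy f"
  proof (rule metric_CauchyI)
    fix \<epsilon> :: real assume \<epsilon>: "0 < \<epsilon>"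
    \<comment> \<open>Chosen so that each of the two terms in \<open>dist\<close> falls below half
      of the square of \<epsilon>.\<close>
    obtain N where N: "4 / \<epsilon>\<^sup>2 < of_nat N"
      using reals_Archimedean2 by blast
    have "dist (f m) (f n) < \<epsilon>" if "m \<ge> N" "n \<ge> N" for m n
    proof -
      have *: "2 / Suc k < \<epsilon>\<^sup>2 / 2" if "k \<ge> N" for k
      proof -
        have "4 / \<epsilon>\<^sup>2 < real (Suc k)"
          using N that by linarith
        then show ?thesis
          using \<epsilon> by (simp add: divide_less_eq less_divide_eq mult.commute del: of_nat_Suc)
      qed
      have "2 / Suc m < \<epsilon>\<^sup>2 / 2" "2 / Suc n < \<epsilon>\<^sup>2 / 2"
        using * that by blast+
      then have "(dist (f m) (f n))\<^sup>2 < \<epsilon>\<^sup>2"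
        using dist[of m n] by linarith
      then show ?thesis
        using \<epsilon> by (simp add: power2_less_imp_less)
    qed
    then show "\<exists>M. \<forall>m\<ge>M. \<forall>n\<ge>M. dist (f m) (f n) < \<epsilon>" by blast
  qed
  then obtain e where e: "f \<longlonglongrightarrow> e"
    by (auto simp: Cauchy_convergent_iff convergent_def)
  have eE: "e \<in> E"
    using E(2) f(1) e by (rule closed_sequentially)
  have "(norm (x - e))\<^sup>2 \<le> d"
  proof (rule LIMSEQ_le)
    show "(\<lambda>n. (norm (x - f n))\<^sup>2) \<longlonglongrightarrow> (norm (x - e))\<^sup>2"
      by (intro tendsto_intros e)
    show "(\<lambda>n. d + 1 / Suc n) \<longlonglongrightarrow> d"
      using tendsto_add[OF tendsto_const LIMSEQ_inverse_real_of_nat, of d] by (simp add: inverse_eq_divide)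
    show "\<exists>N. \<forall>n\<ge>N. (norm (x - f n))\<^sup>2 \<le> d + 1 / Suc n"
      using f(2) less_imp_le by blast
  qed
  then have min: "(norm (x - e))\<^sup>2 \<le> (norm (x - e'))\<^sup>2" if "e' \<in> E" for e'
    by (rule order_trans[OF _ d_le[OF that]])
  have "cinner (x - e) u = 0" if u: "u \<in> E" for u
  proof (cases "u = 0")
    case False
    let ?w = "cscale (cinner (x - e) u / (norm u)\<^sup>2) u"
    have "e + ?w \<in> E"
      using E(1) eE u unfolding csubspace_def by blast
    from min[OF this] have "(norm (x - e))\<^sup>2 \<le> (norm (x - e - ?w))\<^sup>2"
      by (simp add: diff_diff_eq)
    then have "(cmod (cinner (x - e) u))\<^sup>2 / (norm u)\<^sup>2 \<le> 0"
      unfolding norm_diff_proj_sq[OF False] by simp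
    then show ?thesis
      using False by (simp add: divide_le_0_iff)
  qed simp
  with eE show thesis by (rule that)
qed

text \<open>A vector \<open>w\<close> orthogonal to the kernel represents \<open>f\<close> up to a
  scalar, since \<open>f x\<close> times \<open>w\<close> minus \<open>f w\<close> times
  \<open>x\<close> always lies in the kernel.\<close>

lemma Riesz_representation:
  fixes f :: "'a::chilbert \<Rightarrow> complex"
  assumes add: "\<And>x y. f (x + y) = f x + f y"
    and scale: "\<And>c x. f (cscale c x) = c * f x"
    and bound: "\<And>x. cmod (f x) \<le> norm x * K"
  obtains z where "\<And>x. f x = cinner x z"
proof -
  have bl: "bounded_linear f"
    by (rule bounded_linear_intro[OF add _ bound]) (simp add: scale scaleR_cscale scaleR_conv_of_real)
  define E where "E = {x. f x = 0}"
  have f0: "f 0 = 0"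
    using add[of 0 0] by simp
  have E: "csubspace E"
    by (auto simp: E_def csubspace_def add scale f0)
  have cl: "closed E"
    unfolding E_def
    by (intro closed_Collect_eq continuous_intros linear_continuous_on[OF bl])
  show thesis
  proof (cases "E = UNIV")
    case True
    then show thesis
      using that[of 0] by (auto simp: E_def)
  next
    case False
    then obtain x0 where x0: "f x0 \<noteq> 0"
      by (auto simp: E_def)
    obtain e where e: "e \<in> E" "\<And>u. u \<in> E \<Longrightarrow> cinner (x0 - e) u = 0"
      using orthogonal_projection[OF E cl] by blast
    define w where "w = x0 - e"
    have fw: "f w = f x0"
      using e(1) add[of w e] by (simp add: w_def E_def)
    have w0: "w \<noteq> 0"
      using fw x0 f0 by auto
    have "f x = cinner x (cscale (cnj (f w) / (norm w)\<^sup>2) w)" for x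
    proof -
      have "f (cscale (f x) w + cscale (- f w) x) = 0"
        unfolding add scale by simp
      then have "cinner w (cscale (f x) w + cscale (- f w) x) = 0"
        using e(2) by (simp add: E_def w_def)
      then have "cinner (cscale (f x) w + cscale (- f w) x) w = 0"
        by (simp only: cinner_eq_0_commute[of w])
      then have "f x * (norm w)\<^sup>2 = f w * cinner x w"
        by (simp add: cinner_simps cinner_norm)
      then have "f x = f w / (norm w)\<^sup>2 * cinner x w"
        using w0 by (simp add: eq_divide_eq)
      then show ?thesis
        by (simp add: cinner_cscale_right)
    qed
    then show thesis by (rule that)
  qed
qed

text \<open>This justifies the definite description in \<open>cadjoint\<close>: Riesz gives
  existence, \<open>cinner_ext\<close> uniqueness.\<close>

lemma cinner_cadjoint:
  fixes T :: "'a::chilbert \<Rightarrow> 'a"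
  assumes "bounded_clinear T"
  shows "cinner (T x) y = cinner x (cadjoint T y)"
proof -
  obtain K where lin: "clinear T" and K: "\<And>x. norm (T x) \<le> norm x * K"
    using assms by (auto simp: bounded_clinear_def)
  have add: "cinner (T (x + x')) y = cinner (T x) y + cinner (T x') y"
    and scale: "cinner (T (cscale c x)) y = c * cinner (T x) y" for x x' c
    using lin by (simp_all add: clinear_def cinner_simps)
  have bound: "cmod (cinner (T x) y) \<le> norm x * (K * norm y)" for x
    using order_trans[OF cinner_Cauchy_Schwarz mult_right_mono[OF K[of x] norm_ge_zero[of y]]]
    by (simp only: mult.assoc)
  obtain z where z: "\<And>x. cinner (T x) y = cinner x z"
    using Riesz_representation[of "\<lambda>x. cinner (T x) y", OF add scale bound] by metis
  have "z' = z" if "\<forall>x. cinner (T x) y = cinner x z'" for z'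
    using that z by (intro cinner_ext) simp
  then have "cadjoint T y = z"
    unfolding cadjoint_def using z by (intro the_equality) auto
  then show ?thesis by (simp add: z)
qed

lemma bounded_clinear_imp_bounded_linear:
  assumes "bounded_clinear f"
  shows "bounded_linear f"
proof -
  obtain K where "clinear f" "\<And>x. norm (f x) \<le> norm x * K"
    using assms by (auto simp: bounded_clinear_def)
  then show ?thesis
    by (intro bounded_linear_intro[of f K]) (auto simp: clinear_def scaleR_cscale)
qed

section \<open>The symplectic form on pairs\<close>

lemma fst_pscale [simp]: "fst (pscale c v) = cscale c (fst v)"
  and snd_pscale [simp]: "snd (pscale c v) = cscale c (snd v)"
  by (simp_all add: pscale_def)

lemma pscale_zero [simp]: "pscale 0 v = 0" "pscale c 0 = 0"
  by (simp_all add: prod_eq_iff)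

lemma pscale_minus_one [simp]: "pscale (- 1) v = - v"
  by (simp add: prod_eq_iff cscale_one)

lemma scaleR_pscale: "r *\<^sub>R v = pscale (complex_of_real r) v"
  by (simp add: prod_eq_iff scaleR_cscale)

lemma pscale_add_right: "pscale c (v + w) = pscale c v + pscale c w"
  by (simp add: prod_eq_iff cscale_simps)

lemma pscale_pscale: "pscale c (pscale d v) = pscale (c * d) v"
  and pscale_one: "pscale 1 v = v"
  by (simp_all add: prod_eq_iff cscale_simps)

text \<open>Pairs are not made an instance of \<open>complex_inner\<close>, so
  \<open>csubspace\<close> does not apply to them; this is its counterpart for
  \<open>pscale\<close>.\<close>

definition psubspace :: "('a::complex_inner \<times> 'a) set \<Rightarrow> bool" where
  "psubspace M \<longleftrightarrow> 0 \<in> M \<and> (\<forall>v\<in>M. \<forall>w\<in>M. v + w \<in> M) \<and> (\<forall>c. \<forall>v\<in>M. pscale c v \<in> M)"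

lemma psubspace_0: "psubspace M \<Longrightarrow> 0 \<in> M"
  and psubspace_add: "psubspace M \<Longrightarrow> v \<in> M \<Longrightarrow> w \<in> M \<Longrightarrow> v + w \<in> M"
  and psubspace_pscale: "psubspace M \<Longrightarrow> v \<in> M \<Longrightarrow> pscale c v \<in> M"
  by (simp_all add: psubspace_def)

lemma psubspace_uminus: "psubspace M \<Longrightarrow> v \<in> M \<Longrightarrow> - v \<in> M"
  using psubspace_pscale[of M v "- 1"] by simp

lemma psubspace_diff: "psubspace M \<Longrightarrow> v \<in> M \<Longrightarrow> w \<in> M \<Longrightarrow> v - w \<in> M"
  using psubspace_add[of M v "- w"] psubspace_uminus[of M w] by simp

lemma psubspace_imp_subspace: "psubspace M \<Longrightarrow> subspace M"
  by (simp add: psubspace_def subspace_def scaleR_pscale)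

lemma psubspace_sum:
  assumes "psubspace M" "psubspace M'"
  shows "psubspace {v + w |v w. v \<in> M \<and> w \<in> M'}"
  unfolding psubspace_def
proof (intro conjI ballI allI)
  show "0 \<in> {v + w |v w. v \<in> M \<and> w \<in> M'}"
    using assms[THEN psubspace_0] by (metis (mono_tags, lifting) add_0 mem_Collect_eq)
next
  fix x y assume "x \<in> {v + w |v w. v \<in> M \<and> w \<in> M'}" "y \<in> {v + w |v w. v \<in> M \<and> w \<in> M'}"
  then obtain v w v' w' where "v \<in> M" "w \<in> M'" "v' \<in> M" "w' \<in> M'" "x = v + w" "y = v' + w'"
    by blast
  moreover from this have xy: "x + y = (v + v') + (w + w')"
    by (simp only: add_ac)
  ultimately show "x + y \<in> {v + w |v w. v \<in> M \<and> w \<in> M'}"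
    using assms psubspace_add unfolding xy by blast
next
  fix c x assume "x \<in> {v + w |v w. v \<in> M \<and> w \<in> M'}"
  then obtain v w where "v \<in> M" "w \<in> M'" and x: "pscale c x = pscale c v + pscale c w"
    using pscale_add_right by blast
  then show "pscale c x \<in> {v + w |v w. v \<in> M \<and> w \<in> M'}"
    using assms psubspace_pscale unfolding x by blast
qed

lemma in_swap_image_iff: "v \<in> prod.swap ` S \<longleftrightarrow> prod.swap v \<in> S"
  by force

lemma psubspace_swap:
  assumes "psubspace M"
  shows "psubspace (prod.swap ` M)"
proof -
  have "prod.swap (v + w) = prod.swap v + prod.swap w"
    "prod.swap (pscale c v) = pscale c (prod.swap v)" "prod.swap 0 = (0 :: 'a \<times> 'a)"
    for c and v w :: "'a \<times> 'a"
    by (simp_all add: prod_eq_iff)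
  then show ?thesis
    using assms by (simp add: psubspace_def in_swap_image_iff)
qed

lemma symp_add_left: "symp (v + w) u = symp v u + symp w u"
  and symp_add_right: "symp u (v + w) = symp u v + symp u w"
  and symp_diff_left: "symp (v - w) u = symp v u - symp w u"
  and symp_diff_right: "symp u (v - w) = symp u v - symp u w"
  and symp_minus_left: "symp (- v) u = - symp v u"
  and symp_minus_right: "symp u (- v) = - symp u v"
  and symp_pscale_left: "symp (pscale c v) u = c * symp v u"
  and symp_pscale_right: "symp u (pscale c v) = cnj c * symp u v"
  by (simp_all add: symp_def cinner_simps algebra_simps)

lemmas symp_simps = symp_add_left symp_add_right symp_diff_left symp_diff_right
  symp_minus_left symp_minus_right symp_pscale_left symp_pscale_right

lemma symp_zero [simp]: "symp 0 u = 0" "symp u 0 = 0"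
  by (simp_all add: symp_def)

lemma symp_cnj: "symp v w = - cnj (symp w v)"
  using cinner_cnj[of "fst v" "fst w"] cinner_cnj[of "snd v" "snd w"] by (simp add: symp_def)

lemma symp_eq_0_commute: "symp v w = 0 \<longleftrightarrow> symp w v = 0"
  using symp_cnj[of v w] by simp

lemma symp_swap [simp]: "symp (prod.swap v) (prod.swap w) = - symp v w"
  by (simp add: symp_def)

lemma symp_eq_0_iff: "symp v w = 0 \<longleftrightarrow> cinner (fst v) (fst w) = cinner (snd v) (snd w)"
  by (auto simp: symp_def)

text \<open>This is -i[v,v], the real quadratic form of \<open>symp\<close>, as
  \<open>symp_self\<close> records.\<close>

definition hform :: "'a::complex_inner \<times> 'a \<Rightarrow> real" where
  "hform v = (norm (fst v))\<^sup>2 - (norm (snd v))\<^sup>2"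

lemma symp_self: "symp v v = \<i> * complex_of_real (hform v)"
  by (simp add: symp_def hform_def cinner_norm algebra_simps)

lemma hform_swap [simp]: "hform (prod.swap v) = - hform v"
  by (simp add: hform_def)

lemma hform_pscale: "hform (pscale c v) = (cmod c)\<^sup>2 * hform v"
  by (simp add: hform_def norm_cscale power_mult_distrib algebra_simps)

lemma hform_add:
  assumes "symp v w = 0"
  shows "hform (v + w) = hform v + hform w"
proof -
  have "cinner (fst v) (fst w) = cinner (snd v) (snd w)"
    using assms by (simp add: symp_eq_0_iff)
  then show ?thesis
    by (simp add: hform_def norm_add_sq)
qed

lemma norm_prod_sq: "(norm v)\<^sup>2 = (norm (fst v))\<^sup>2 + (norm (snd v))\<^sup>2"
  by (simp add: norm_prod_def)

lemma psubspace_sperp: "psubspace (sperp S)"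
  by (simp add: psubspace_def sperp_def symp_simps)

lemma closed_sperp: "closed (sperp S)"
proof -
  have "sperp S = (\<Inter>w\<in>S. {v. symp v w = 0})"
    by (auto simp: sperp_def)
  then show ?thesis
    by (auto simp: symp_def intro!: closed_INT closed_Collect_eq continuous_intros)
qed

lemma sperp_swap: "sperp (prod.swap ` S) = prod.swap ` sperp S"
proof (rule set_eqI)
  fix v :: "'a \<times> 'a"
  have "symp v (prod.swap w) = - symp (prod.swap v) w" for w
    using symp_swap[of "prod.swap v" w] by simp
  then show "v \<in> sperp (prod.swap ` S) \<longleftrightarrow> v \<in> prod.swap ` sperp S"
    unfolding in_swap_image_iff by (simp add: sperp_def)
qed

section \<open>Quotients by closed isotropic subspaces\<close>

locale isotropic =
  fixes A :: "('a::chilbert \<times> 'a) set"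
  assumes sub: "psubspace A" and closed_A: "closed A" and iso: "A \<subseteq> sperp A"
begin

lemma mem_qcls: "u \<in> qcls A v \<longleftrightarrow> u - v \<in> A"
proof
  assume "u - v \<in> A"
  then show "u \<in> qcls A v"
    unfolding qcls_def by (intro image_eqI[of _ _ "u - v"]) (simp only: add_diff_eq add_diff_cancel_left')
qed (auto simp: qcls_def)

lemma qcls_eq_iff: "qcls A v = qcls A w \<longleftrightarrow> v - w \<in> A"
proof
  assume "qcls A v = qcls A w"
  moreover have "v \<in> qcls A v"
    using psubspace_0[OF sub] by (simp add: mem_qcls)
  ultimately show "v - w \<in> A"
    by (simp add: mem_qcls)
next
  assume *: "v - w \<in> A"
  have "u - v \<in> A \<longleftrightarrow> u - w \<in> A" for u
    using psubspace_add[OF sub _ *, of "u - v"] psubspace_diff[OF sub _ *, of "u - w"] by auto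
  then show "qcls A v = qcls A w"
    by (auto simp: mem_qcls)
qed

lemma qcls_0: "qcls A 0 = A"
  by (simp add: qcls_def)

lemma qcls_eq_A_iff: "qcls A v = A \<longleftrightarrow> v \<in> A"
  using qcls_eq_iff[of v 0] by (simp add: qcls_0)

text \<open>The representative in the quotient operations is an arbitrary choice. Each operation is
  shown to be independent of it by bounding the ambiguity to \<open>A\<close> in this way.\<close>

lemma qrep_qcls: "qrep (qcls A v) - v \<in> A"
proof -
  have "qrep (qcls A v) \<in> qcls A v"
    unfolding qrep_def
    by (rule someI[of _ v]) (simp add: mem_qcls psubspace_0[OF sub])
  then show ?thesis by (simp add: mem_qcls)
qed

lemma qadd_qcls: "qadd A (qcls A v) (qcls A w) = qcls A (v + w)"
proof -
  have "qrep (qcls A v) + qrep (qcls A w) - (v + w)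
      = (qrep (qcls A v) - v) + (qrep (qcls A w) - w)"
    by simp
  then show ?thesis
    unfolding qadd_def qcls_eq_iff using qrep_qcls psubspace_add[OF sub] by metis
qed

lemma qscale_qcls: "qscale A c (qcls A v) = qcls A (pscale c v)"
proof -
  have "pscale c (qrep (qcls A v)) - pscale c v = pscale c (qrep (qcls A v) - v)"
    by (simp add: prod_eq_iff cscale_simps)
  then show ?thesis
    unfolding qscale_def qcls_eq_iff using qrep_qcls psubspace_pscale[OF sub] by metis
qed

lemma qdiff_qcls: "qdiff A (qcls A v) (qcls A w) = qcls A (v - w)"
  by (simp add: qdiff_def qscale_qcls qadd_qcls)

lemma symp_A: "v \<in> sperp A \<Longrightarrow> a \<in> A \<Longrightarrow> symp v a = 0"
  and symp_A': "v \<in> sperp A \<Longrightarrow> a \<in> A \<Longrightarrow> symp a v = 0"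
  by (auto simp: sperp_def symp_eq_0_commute)

lemma qsymp_qcls:
  assumes "v \<in> sperp A" "w \<in> sperp A"
  shows "qsymp (qcls A v) (qcls A w) = symp v w"
proof -
  define a b where "a = qrep (qcls A v) - v" and "b = qrep (qcls A w) - w"
  have ab: "a \<in> A" "b \<in> A"
    using qrep_qcls by (simp_all add: a_def b_def)
  then have "symp v b = 0" "symp a w = 0" "symp a b = 0"
    using assms iso symp_A symp_A' by blast+
  then have "symp (v + a) (w + b) = symp v w"
    by (simp add: symp_simps)
  then show ?thesis by (simp add: qsymp_def a_def b_def)
qed

lemma qpos_qcls: "v \<in> sperp A \<Longrightarrow> qpos (qcls A v) = hform v"
  and qneg_qcls: "v \<in> sperp A \<Longrightarrow> qneg (qcls A v) = - hform v"
  by (simp_all add: qpos_def qneg_def qsymp_qcls symp_self)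

lemma qcls_in_qspace: "v \<in> sperp A \<Longrightarrow> qcls A v \<in> qspace A"
  by (simp add: qspace_def)

lemma qnorm_le: "w - v \<in> A \<Longrightarrow> qnorm (qcls A v) \<le> norm w"
  unfolding qnorm_def by (rule cINF_lower) (auto intro!: bdd_belowI[of _ 0] simp: mem_qcls)

lemma qnorm_greatest: "(\<And>w. w - v \<in> A \<Longrightarrow> c \<le> norm w) \<Longrightarrow> c \<le> qnorm (qcls A v)"
proof -
  assume *: "\<And>w. w - v \<in> A \<Longrightarrow> c \<le> norm w"
  have "v \<in> qcls A v"
    using psubspace_0[OF sub] by (simp add: mem_qcls)
  then have "qcls A v \<noteq> {}"
    by blast
  then show ?thesis
    unfolding qnorm_def by (rule cINF_greatest) (simp add: * mem_qcls)
qed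

lemma qnorm_nonneg: "0 \<le> qnorm (qcls A v)"
  by (rule qnorm_greatest) simp

lemma qnorm_approx:
  assumes "0 < \<epsilon>"
  obtains a where "a \<in> A" "norm (v + a) < qnorm (qcls A v) + \<epsilon>"
proof -
  have "\<not> (\<forall>w. w - v \<in> A \<longrightarrow> qnorm (qcls A v) + \<epsilon> \<le> norm w)"
    using qnorm_greatest[of v "qnorm (qcls A v) + \<epsilon>"] assms by fastforce
  then obtain w where "w - v \<in> A" "norm w < qnorm (qcls A v) + \<epsilon>"
    by force
  then show thesis
    using that[of "w - v"] by simp
qed

text \<open>A subspace containing \<open>A\<close> is a union of cosets, so membership can be tested
  on any representative.\<close>

lemma qcls_in_image_iff:
  assumes "psubspace M" "A \<subseteq> M"
  shows "qcls A v \<in> qcls A ` M \<longleftrightarrow> v \<in> M"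
proof
  assume "qcls A v \<in> qcls A ` M"
  then obtain m where "m \<in> M" "v - m \<in> A"
    by (auto simp: qcls_eq_iff)
  then show "v \<in> M"
    using assms psubspace_add[of M m "v - m"] by auto
qed simp

lemma qsubspace_image:
  assumes "psubspace M" "M \<subseteq> sperp A"
  shows "qsubspace A (qcls A ` M)"
  unfolding qsubspace_def
proof (intro conjI ballI allI)
  show "A \<in> qcls A ` M"
    using psubspace_0[OF assms(1)] qcls_0 by (metis imageI)
  show "qcls A ` M \<subseteq> qspace A"
    using assms(2) by (auto simp: qspace_def)
next
  fix \<xi> \<eta> assume "\<xi> \<in> qcls A ` M" "\<eta> \<in> qcls A ` M"
  then show "qadd A \<xi> \<eta> \<in> qcls A ` M"
    using psubspace_add[OF assms(1)] by (elim imageE) (simp add: qadd_qcls)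
next
  fix c \<xi> assume "\<xi> \<in> qcls A ` M"
  then show "qscale A c \<xi> \<in> qcls A ` M"
    using psubspace_pscale[OF assms(1)] by (elim imageE) (simp add: qscale_qcls)
qed

text \<open>Convergence in the quotient norm lifts to pairs: a correction from \<open>A\<close>
  brings each difference within \<open>1 / Suc n\<close> of the infimum, and the corrected sequence
  stays in \<open>M\<close> and converges in norm.\<close>

lemma qclosed_image:
  assumes M: "psubspace M" "closed M" "A \<subseteq> M"
  shows "qclosed A (qcls A ` M)"
  unfolding qclosed_def
proof (intro allI impI, elim conjE)
  fix f \<xi>
  assume f: "\<forall>n. f n \<in> qcls A ` M" and \<xi>: "\<xi> \<in> qspace A"
    and lim: "(\<lambda>n. qnorm (qdiff A (f n) \<xi>)) \<longlonglongrightarrow> 0"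
  obtain v where v: "\<xi> = qcls A v"
    using \<xi> by (auto simp: qspace_def)
  have "\<forall>n. \<exists>m. m \<in> M \<and> f n = qcls A m"
    using f by blast
  then obtain m where m: "\<And>n. m n \<in> M" "\<And>n. f n = qcls A (m n)"
    using choice[of "\<lambda>n m. m \<in> M \<and> f n = qcls A m"] by blast
  have "\<exists>a\<in>A. norm (m n - v + a) < qnorm (qdiff A (f n) \<xi>) + 1 / Suc n" for n
    using qnorm_approx[of "1 / Suc n" "m n - v"] by (auto simp: m(2) v qdiff_qcls)
  then have "\<forall>n. \<exists>a. a \<in> A \<and> norm (m n - v + a) < qnorm (qdiff A (f n) \<xi>) + 1 / Suc n"
    by blast
  then obtain a where a: "\<And>n. a n \<in> A"
    "\<And>n. norm (m n - v + a n) < qnorm (qdiff A (f n) \<xi>) + 1 / Suc n"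
    using choice[of "\<lambda>n a. a \<in> A \<and> norm (m n - v + a) < qnorm (qdiff A (f n) \<xi>) + 1 / Suc n"]
    by blast
  have "(\<lambda>n. qnorm (qdiff A (f n) \<xi>) + 1 / Suc n) \<longlonglongrightarrow> 0"
    using tendsto_add[OF lim LIMSEQ_inverse_real_of_nat] by (simp add: inverse_eq_divide)
  then have "(\<lambda>n. m n - v + a n) \<longlonglongrightarrow> 0"
    by (rule Lim_null_comparison[rotated]) (use a(2) less_imp_le in \<open>blast intro: always_eventually\<close>)
  then have "(\<lambda>n. (m n - v + a n) + v) \<longlonglongrightarrow> 0 + v"
    by (intro tendsto_intros)
  then have lim_v: "(\<lambda>n. m n + a n) \<longlonglongrightarrow> v"
    by simp
  have "m n + a n \<in> M" for n
    using m(1) a(1) M psubspace_add by blast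
  then have "v \<in> M"
    by (rule closed_sequentially[OF M(2) _ lim_v])
  then show "\<xi> \<in> qcls A ` M"
    by (simp add: v)
qed

text \<open>\<open>M\<close> is the full preimage of \<open>L\<close>. It is closed because the
  quotient map does not increase norms.\<close>

lemma qclosed_subspace_lift:
  assumes L: "qsubspace A L" "qclosed A L"
  obtains M where "psubspace M" "closed M" "A \<subseteq> M" "M \<subseteq> sperp A" "L = qcls A ` M"
proof
  define M where "M = {v \<in> sperp A. qcls A v \<in> L}"
  show "psubspace M"
    unfolding psubspace_def
  proof (intro conjI ballI allI)
    show "0 \<in> M"
      using L(1) psubspace_0[OF psubspace_sperp] by (simp add: M_def qsubspace_def qcls_0)
  next
    fix v w assume "v \<in> M" "w \<in> M"
    then show "v + w \<in> M"
      using L(1) psubspace_add[OF psubspace_sperp]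
      unfolding M_def qsubspace_def mem_Collect_eq qadd_qcls[symmetric] by blast
  next
    fix c v assume "v \<in> M"
    then show "pscale c v \<in> M"
      using L(1) psubspace_pscale[OF psubspace_sperp]
      unfolding M_def qsubspace_def mem_Collect_eq qscale_qcls[symmetric] by blast
  qed
  show "A \<subseteq> M"
  proof
    fix a assume "a \<in> A"
    then show "a \<in> M"
      using L(1) iso qcls_eq_A_iff[of a] by (auto simp: M_def qsubspace_def)
  qed
  show "M \<subseteq> sperp A"
    by (auto simp: M_def)
  show "L = qcls A ` M"
    using L(1) by (auto simp: M_def qsubspace_def qspace_def)
  show "closed M"
    unfolding closed_sequential_limits
  proof (intro allI impI, elim conjE)
    fix f v assume f: "\<forall>n. f n \<in> M" and lim: "f \<longlonglongrightarrow> v"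
    have v: "v \<in> sperp A"
      by (rule closed_sequentially[OF closed_sperp _ lim]) (use f in \<open>simp add: M_def\<close>)
    have "(\<lambda>n. f n - v) \<longlonglongrightarrow> 0"
      using lim by (simp add: LIM_zero)
    then have lim0: "(\<lambda>n. norm (f n - v)) \<longlonglongrightarrow> 0"
      by (rule tendsto_norm_zero)
    have "norm (qnorm (qcls A (f n - v))) \<le> norm (f n - v)" for n
      using qnorm_le[of "f n - v" "f n - v"] qnorm_nonneg[of "f n - v"] psubspace_0[OF sub] by simp
    then have "(\<lambda>n. qnorm (qcls A (f n - v))) \<longlonglongrightarrow> 0"
      by (intro Lim_null_comparison[OF always_eventually[OF allI] lim0])
    then have "(\<lambda>n. qnorm (qdiff A (qcls A (f n)) (qcls A v))) \<longlonglongrightarrow> 0"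
      by (simp add: qdiff_qcls)
    then have "qcls A v \<in> L"
      using L(2)[unfolded qclosed_def, rule_format, of "\<lambda>n. qcls A (f n)"] f qcls_in_qspace[OF v]
      by (simp add: M_def)
    with v show "v \<in> M"
      by (simp add: M_def)
  qed
qed

end

section \<open>The reduced planes\<close>

definition Npos :: "('a::complex_inner \<times> 'a) set \<Rightarrow> complex \<Rightarrow> ('a \<times> 'a) set" where
  "Npos A z = {(x, cscale z x) | x. True} \<inter> sperp A"

definition Nneg :: "('a::complex_inner \<times> 'a) set \<Rightarrow> complex \<Rightarrow> ('a \<times> 'a) set" where
  "Nneg A z = {(cscale z x, x) | x. True} \<inter> sperp A"

lemma in_Npos_iff: "v \<in> Npos A z \<longleftrightarrow> snd v = cscale z (fst v) \<and> v \<in> sperp A"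
  by (cases v) (auto simp: Npos_def)

lemma in_Nneg_iff: "v \<in> Nneg A z \<longleftrightarrow> fst v = cscale z (snd v) \<and> v \<in> sperp A"
  by (cases v) (auto simp: Nneg_def)

lemma Nneg_swap: "Nneg A z = prod.swap ` Npos (prod.swap ` A) z"
  by (rule set_eqI) (simp add: in_swap_image_iff in_Npos_iff in_Nneg_iff sperp_swap)

lemma psubspace_Npos: "psubspace (Npos A z)"
  using psubspace_sperp[of A]
  by (simp add: psubspace_def in_Npos_iff cscale_simps mult.commute)

lemma psubspace_Nneg: "psubspace (Nneg A z)"
  using psubspace_sperp[of A]
  by (simp add: psubspace_def in_Nneg_iff cscale_simps mult.commute)

lemma symp_Npos_Nneg: "v \<in> Npos A z \<Longrightarrow> w \<in> Nneg A (cnj z) \<Longrightarrow> symp v w = 0"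
  by (simp add: in_Npos_iff in_Nneg_iff symp_def cinner_simps)

lemma hform_Npos: "v \<in> Npos A z \<Longrightarrow> hform v = (1 - (cmod z)\<^sup>2) * (norm (fst v))\<^sup>2"
  by (simp add: in_Npos_iff hform_def norm_cscale power_mult_distrib algebra_simps)

lemma hform_Nneg: "v \<in> Nneg A z \<Longrightarrow> hform v = - (1 - (cmod z)\<^sup>2) * (norm (snd v))\<^sup>2"
  by (simp add: in_Nneg_iff hform_def norm_cscale power_mult_distrib algebra_simps)

text \<open>The factor 1/2 arises because the squared norm of a point of the plane is 1 + |z|^2,
  hence at most 2, times that of its first coordinate.\<close>

lemma hform_Npos_ge:
  assumes "cmod z < 1" "v \<in> Npos A z"
  shows "(1 - (cmod z)\<^sup>2) / 2 * (norm v)\<^sup>2 \<le> hform v"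
proof -
  have z: "(cmod z)\<^sup>2 < 1"
    using assms(1) by (simp add: power_less_one_iff)
  have "(norm v)\<^sup>2 = (1 + (cmod z)\<^sup>2) * (norm (fst v))\<^sup>2"
    using assms(2)
    by (simp add: norm_prod_sq in_Npos_iff norm_cscale power_mult_distrib algebra_simps)
  also have "\<dots> \<le> 2 * (norm (fst v))\<^sup>2"
    using z by (intro mult_right_mono) auto
  finally have "(1 - (cmod z)\<^sup>2) / 2 * (norm v)\<^sup>2 \<le> (1 - (cmod z)\<^sup>2) / 2 * (2 * (norm (fst v))\<^sup>2)"
    using z by (intro mult_left_mono) auto
  then show ?thesis
    using hform_Npos[OF assms(2)] by simp
qed

lemma hform_Nneg_le:
  assumes "cmod z < 1" "v \<in> Nneg A z"
  shows "(1 - (cmod z)\<^sup>2) / 2 * (norm v)\<^sup>2 \<le> - hform v"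
proof -
  have "prod.swap v \<in> Npos (prod.swap ` A) z"
    using assms(2) by (simp add: Nneg_swap in_swap_image_iff)
  from hform_Npos_ge[OF assms(1) this] show ?thesis
    by (simp add: norm_prod_sq add.commute)
qed

section \<open>Splitting, definiteness, maximality and complements of the reduced planes\<close>

context isotropic
begin

lemma norm_fst_eq_norm_snd:
  assumes "a \<in> A"
  shows "norm (fst a) = norm (snd a)"
proof -
  have "symp a a = 0"
    using iso assms by (auto simp: sperp_def)
  then have "hform a = 0"
    by (simp add: symp_self)
  then show ?thesis
    by (simp add: hform_def power2_eq_iff_nonneg)
qed

text \<open>Both coordinates of an element of \<open>A\<close> have equal norm, so the map is
  bounded below on \<open>A\<close> and its image is complete. This makes orthogonal projection onto
  the image available in \<open>sperp_decomposition\<close>.\<close>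

lemma closed_reduction_image:
  assumes "cmod z < 1"
  shows "closed ((\<lambda>a. fst a - cscale (cnj z) (snd a)) ` A)"
proof -
  let ?f = "\<lambda>a :: 'a \<times> 'a. fst a - cscale (cnj z) (snd a)"
  have bl: "bounded_linear ?f"
    by (intro bounded_linear_sub bounded_linear_fst
        bounded_linear_compose[OF bounded_bilinear.bounded_linear_right[OF bounded_bilinear_cscale]]
        bounded_linear_snd)
  have "complete (?f ` A)"
  proof (rule complete_isometric_image[OF _ psubspace_imp_subspace[OF sub] bl])
    show "0 < (1 - cmod z) / 2"
      using assms by simp
    show "\<forall>a\<in>A. (1 - cmod z) / 2 * norm a \<le> norm (?f a)"
    proof
      fix a assume "a \<in> A"
      then have eq: "norm (fst a) = norm (snd a)"
        by (rule norm_fst_eq_norm_snd)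
      have "norm a \<le> 2 * norm (fst a)"
        using norm_Pair_le[of "fst a" "snd a"] eq by simp
      then have "(1 - cmod z) / 2 * norm a \<le> (1 - cmod z) / 2 * (2 * norm (fst a))"
        using assms by (intro mult_left_mono) auto
      also have "\<dots> = norm (fst a) - norm (cscale (cnj z) (snd a))"
        using eq by (simp add: norm_cscale left_diff_distrib)
      also have "\<dots> \<le> norm (?f a)"
        by (rule norm_triangle_ineq2)
      finally show "(1 - cmod z) / 2 * norm a \<le> norm (?f a)" .
    qed
    show "complete A"
      using closed_A by (simp add: complete_eq_closed)
  qed
  then show ?thesis
    by (rule complete_imp_closed)
qed

text \<open>The Moebius transformation \<open>(p, q) \<mapsto> (p - cnj z q, q - z p)\<close> preserves the form up to the
factor \<open>1 - |z|\<^sup>2\<close> and moves the planes at \<open>z\<close> and \<open>cnj z\<close> to the coordinate planes; there the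
component in \<open>A\<close> is read off by an orthogonal projection of the first coordinate.\<close>

lemma sperp_decomposition:
  assumes z: "cmod z < 1" and v: "v \<in> sperp A"
  obtains p m a where "p \<in> Npos A z" "m \<in> Nneg A (cnj z)" "a \<in> A" "v = p + m + a"
proof -
  let ?f = "\<lambda>a :: 'a \<times> 'a. fst a - cscale (cnj z) (snd a)"
  have "csubspace (?f ` A)"
    unfolding csubspace_def
  proof (intro conjI ballI allI)
    show "0 \<in> ?f ` A"
      using psubspace_0[OF sub] by (intro image_eqI[of _ _ 0]) auto
  next
    fix x y assume "x \<in> ?f ` A" "y \<in> ?f ` A"
    then obtain a b where "a \<in> A" "b \<in> A" "x = ?f a" "y = ?f b"
      by blast
    then show "x + y \<in> ?f ` A"
      using psubspace_add[OF sub]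
      by (intro image_eqI[of _ _ "a + b"]) (auto simp: cscale_simps)
  next
    fix c x assume "x \<in> ?f ` A"
    then obtain a where "a \<in> A" "x = ?f a"
      by blast
    then show "cscale c x \<in> ?f ` A"
      using psubspace_pscale[OF sub]
      by (intro image_eqI[of _ _ "pscale c a"]) (auto simp: cscale_simps mult.commute)
  qed
  \<comment> \<open>Projecting the first transformed coordinate of \<open>v\<close> singles out the
    \<open>A\<close> component \<open>a\<close>; after subtracting it, that coordinate is orthogonal
    to the image of \<open>A\<close>.\<close>
  then obtain e where e: "e \<in> ?f ` A" "\<And>u. u \<in> ?f ` A \<Longrightarrow> cinner (?f v - e) u = 0"
    using orthogonal_projection[OF _ closed_reduction_image[OF z]] by blast
  then obtain a where a: "a \<in> A" "e = ?f a"
    by blast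
  define w where "w = v - a"
  have w: "w \<in> sperp A"
    unfolding w_def using v a(1) iso psubspace_diff[OF psubspace_sperp] by blast
  define x y where "x = fst w - cscale (cnj z) (snd w)" and "y = snd w - cscale z (fst w)"
  have "x = ?f v - e"
    by (simp add: x_def w_def a(2) cscale_simps)
  then have x: "cinner x (?f b) = 0" if "b \<in> A" for b
    using e(2) that by blast
  \<comment> \<open>The second coordinate needs no projection: \<open>w\<close> is symplectically
    orthogonal to \<open>A\<close>, and the transformation preserves the form up to a factor, so the
    two inner products agree.\<close>
  have y: "cinner y (snd b - cscale z (fst b)) = 0" if b: "b \<in> A" for b
  proof -
    have "cinner (fst w) (fst b) = cinner (snd w) (snd b)"
      using w b by (simp add: sperp_def symp_eq_0_iff)
    then have "cinner y (snd b - cscale z (fst b)) = cinner x (?f b)"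
      by (simp add: x_def y_def cinner_simps algebra_simps)
    then show ?thesis
      using x[OF b] by simp
  qed
  \<comment> \<open>Transforming and then recombining the two planes multiplies \<open>w\<close> by
    1 - |z|^2; \<open>r\<close> undoes this factor.\<close>
  define r where "r = 1 / (1 - z * cnj z)"
  have "z * cnj z \<noteq> 1"
  proof
    assume "z * cnj z = 1"
    then have "(cmod z)\<^sup>2 = 1"
      by (metis complex_norm_square of_real_eq_1_iff)
    then show False
      using power_less_one_iff[of "cmod z" 2] z by simp
  qed
  then have r: "r * (1 - z * cnj z) = 1"
    by (simp add: r_def)
  show thesis
  proof
    have "symp (x, cscale z x) b = 0" if "b \<in> A" for b
      using x[OF that] by (simp add: symp_eq_0_iff cinner_simps)
    then have "(x, cscale z x) \<in> Npos A z"
      by (simp add: in_Npos_iff sperp_def)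
    then show "pscale r (x, cscale z x) \<in> Npos A z"
      by (rule psubspace_pscale[OF psubspace_Npos])
    have "symp (cscale (cnj z) y, y) b = 0" if "b \<in> A" for b
      using y[OF that] by (simp add: symp_eq_0_iff cinner_simps)
    then have "(cscale (cnj z) y, y) \<in> Nneg A (cnj z)"
      by (simp add: in_Nneg_iff sperp_def)
    then show "pscale r (cscale (cnj z) y, y) \<in> Nneg A (cnj z)"
      by (rule psubspace_pscale[OF psubspace_Nneg])
    have "x + cscale (cnj z) y = cscale (1 - z * cnj z) (fst w)"
      "cscale z x + y = cscale (1 - z * cnj z) (snd w)"
      by (simp_all add: x_def y_def cscale_simps mult.commute)
    then have "(x, cscale z x) + (cscale (cnj z) y, y) = pscale (1 - z * cnj z) w"
      by (simp add: prod_eq_iff)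
    then have "pscale r (x, cscale z x) + pscale r (cscale (cnj z) y, y) = w"
      by (simp only: pscale_add_right[symmetric] pscale_pscale r pscale_one)
    then show "v = pscale r (x, cscale z x) + pscale r (cscale (cnj z) y, y) + a"
      by (simp add: w_def)
  qed (fact a(1))
qed

text \<open>In the splitting of a vector from the right side, the negative part \<open>m\<close> is
  symplectically orthogonal to every summand except itself, hence to itself, and definiteness kills
  it. Being a symplectic complement, the sum is closed, as \<open>qclosed_image\<close>
  requires.\<close>

lemma Npos_plus_A:
  assumes z: "cmod z < 1"
  shows "{p + a |p a. p \<in> Npos A z \<and> a \<in> A} = sperp (A \<union> Nneg A (cnj z))" (is "?M = ?N")
proof
  show "?M \<subseteq> ?N"
  proof
    fix v assume "v \<in> ?M"
    then obtain p a where "p \<in> Npos A z" "a \<in> A" "v = p + a"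
      by blast
    moreover from this have "symp p m = 0" "symp a m = 0" if "m \<in> Nneg A (cnj z)" for m
      using symp_Npos_Nneg[of p A z m] symp_A'[of m a] that by (simp_all add: in_Nneg_iff)
    ultimately show "v \<in> ?N"
      using iso by (auto simp: sperp_def symp_add_left in_Npos_iff)
  qed
  show "?N \<subseteq> ?M"
  proof
    fix v assume v: "v \<in> ?N"
    then have "v \<in> sperp A"
      by (simp add: sperp_def)
    then obtain p m a where pma: "p \<in> Npos A z" "m \<in> Nneg A (cnj z)" "a \<in> A" "v = p + m + a"
      by (rule sperp_decomposition[OF z])
    have "symp v m = 0" "symp p m = 0" "symp a m = 0"
      using v pma(2) symp_Npos_Nneg[OF pma(1,2)] symp_A'[OF _ pma(3), of m]
      by (simp_all add: sperp_def in_Nneg_iff)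
    then have "symp m m = 0"
      using pma(4) by (simp add: symp_simps)
    then have "(1 - (cmod z)\<^sup>2) / 2 * (norm m)\<^sup>2 \<le> 0"
      using hform_Nneg_le[of "cnj z" m A] pma(2) z by (simp add: symp_self)
    then have "m = 0"
      using power_less_one_iff[of "cmod z" 2] z by (auto simp: mult_le_0_iff)
    then have "v = p + a"
      using pma(4) by simp
    then show "v \<in> ?M"
      using pma(1,3) by blast
  qed
qed

text \<open>The mirror image of \<open>Npos_plus_A\<close>; splitting at \<open>cnj z\<close> puts
  the negative part into \<open>Nneg A z\<close>.\<close>

lemma Nneg_plus_A:
  assumes z: "cmod z < 1"
  shows "{m + a |m a. m \<in> Nneg A z \<and> a \<in> A} = sperp (A \<union> Npos A (cnj z))" (is "?M = ?N")
proof
  show "?M \<subseteq> ?N"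
  proof
    fix v assume "v \<in> ?M"
    then obtain m a where "m \<in> Nneg A z" "a \<in> A" "v = m + a"
      by blast
    moreover from this have "symp m p = 0" "symp a p = 0" if "p \<in> Npos A (cnj z)" for p
      using symp_Npos_Nneg[of p A "cnj z" m] symp_eq_0_commute[of m p] symp_A'[of p a] that
      by (simp_all add: in_Npos_iff)
    ultimately show "v \<in> ?N"
      using iso by (auto simp: sperp_def symp_add_left in_Nneg_iff)
  qed
  show "?N \<subseteq> ?M"
  proof
    fix v assume v: "v \<in> ?N"
    then have "v \<in> sperp A"
      by (simp add: sperp_def)
    then obtain p m a where pma: "p \<in> Npos A (cnj z)" "m \<in> Nneg A z" "a \<in> A" "v = p + m + a"
      using sperp_decomposition[of "cnj z"] z unfolding complex_mod_cnj complex_cnj_cnj by blast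
    have "symp v p = 0" "symp m p = 0" "symp a p = 0"
      using v pma(1,2) symp_Npos_Nneg[of p A "cnj z" m] symp_A'[OF _ pma(3), of p] symp_eq_0_commute[of m p]
      by (simp_all add: sperp_def in_Npos_iff)
    then have "symp p p = 0"
      using pma(4) by (simp add: symp_simps)
    then have "(1 - (cmod z)\<^sup>2) / 2 * (norm p)\<^sup>2 \<le> 0"
      using hform_Npos_ge[of "cnj z" p A] pma(1) z by (simp add: symp_self)
    then have "p = 0"
      using power_less_one_iff[of "cmod z" 2] z by (auto simp: mult_le_0_iff)
    then have "v = m + a"
      using pma(4) by simp
    then show "v \<in> ?M"
      using pma(2,3) by blast
  qed
qed

text \<open>The factor \<open>s\<close> is a sign, 1 for \<open>Wplus\<close> and -1 for
  \<open>Wminus\<close>. Maximality holds because a definite \<open>L'\<close> containing the image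
  of \<open>P\<close> would also contain the class of the remainder \<open>m\<close>, on which the
  form has the wrong sign, so that class is zero.\<close>

lemma maximal_definite:
  fixes s c :: real
  assumes P: "psubspace P" "P \<subseteq> sperp A" "closed {p + a |p a. p \<in> P \<and> a \<in> A}"
    and c: "0 < c" "\<And>p. p \<in> P \<Longrightarrow> c * (norm p)\<^sup>2 \<le> s * hform p"
    and decomposition: "\<And>v. v \<in> sperp A \<Longrightarrow>
      \<exists>p m a. p \<in> P \<and> m \<in> sperp A \<and> a \<in> A \<and> s * hform m \<le> 0 \<and> v = p + m + a"
  shows "qsubspace A (qcls A ` P)"
    and "qclosed A (qcls A ` P)"
    and "\<forall>\<xi>\<in>qcls A ` P. \<xi> \<noteq> A \<longrightarrow> 0 < s * qpos \<xi>"
    and "\<exists>c>0. \<forall>\<xi>\<in>qcls A ` P. c * (qnorm \<xi>)\<^sup>2 \<le> s * qpos \<xi>"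
    and "\<forall>L'. qsubspace A L' \<and> qclosed A L' \<and> (\<forall>\<xi>\<in>L'. \<xi> \<noteq> A \<longrightarrow> 0 < s * qpos \<xi>) \<and>
      qcls A ` P \<subseteq> L' \<longrightarrow> L' = qcls A ` P"
proof -
  let ?M = "{p + a |p a. p \<in> P \<and> a \<in> A}"
  show "qsubspace A (qcls A ` P)"
    using P(1,2) by (rule qsubspace_image)
  have *: "qcls A (p + a) = qcls A p" if "a \<in> A" for p a
    using that by (simp add: qcls_eq_iff)
  have M: "qcls A ` ?M = qcls A ` P"
  proof
    show "qcls A ` ?M \<subseteq> qcls A ` P"
      using * by auto
    have "p \<in> ?M" if "p \<in> P" for p
      using that psubspace_0[OF sub] by (intro CollectI exI[of _ p] exI[of _ 0]) simp
    then show "qcls A ` P \<subseteq> qcls A ` ?M"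
      by blast
  qed
  have "a \<in> ?M" if "a \<in> A" for a
    using that psubspace_0[OF P(1)] by (intro CollectI exI[of _ 0] exI[of _ a]) simp
  then have "A \<subseteq> ?M"
    by blast
  then show "qclosed A (qcls A ` P)"
    using qclosed_image[OF psubspace_sum[OF P(1) sub] P(3)] by (simp only: M)
  show "\<forall>\<xi>\<in>qcls A ` P. \<xi> \<noteq> A \<longrightarrow> 0 < s * qpos \<xi>"
  proof (intro ballI impI, elim imageE)
    fix \<xi> p assume p: "\<xi> \<noteq> A" "\<xi> = qcls A p" "p \<in> P"
    then have "p \<noteq> 0"
      using qcls_0 by auto
    then have "0 < c * (norm p)\<^sup>2"
      using c(1) by simp
    also have "\<dots> \<le> s * qpos \<xi>"
      using c(2)[OF p(3)] p(2,3) P(2) by (auto simp: qpos_qcls)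
    finally show "0 < s * qpos \<xi>" .
  qed
  have "c * (qnorm \<xi>)\<^sup>2 \<le> s * qpos \<xi>" if "\<xi> \<in> qcls A ` P" for \<xi>
  proof -
    from that obtain p where p: "p \<in> P" "\<xi> = qcls A p"
      by blast
    have "qnorm \<xi> \<le> norm p" "0 \<le> qnorm \<xi>"
      using qnorm_le[of p p] qnorm_nonneg psubspace_0[OF sub] p(2) by auto
    then have "c * (qnorm \<xi>)\<^sup>2 \<le> c * (norm p)\<^sup>2"
      using c(1) by (intro mult_left_mono power_mono) auto
    also have "\<dots> \<le> s * qpos \<xi>"
      using c(2)[OF p(1)] p P(2) by (auto simp: qpos_qcls)
    finally show ?thesis .
  qed
  then show "\<exists>c>0. \<forall>\<xi>\<in>qcls A ` P. c * (qnorm \<xi>)\<^sup>2 \<le> s * qpos \<xi>"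
    using c(1) by blast
  show "\<forall>L'. qsubspace A L' \<and> qclosed A L' \<and> (\<forall>\<xi>\<in>L'. \<xi> \<noteq> A \<longrightarrow> 0 < s * qpos \<xi>) \<and>
      qcls A ` P \<subseteq> L' \<longrightarrow> L' = qcls A ` P"
  proof (intro allI impI, elim conjE)
    fix L' assume L': "qsubspace A L'" "\<forall>\<xi>\<in>L'. \<xi> \<noteq> A \<longrightarrow> 0 < s * qpos \<xi>" "qcls A ` P \<subseteq> L'"
    have "\<xi> \<in> qcls A ` P" if \<xi>: "\<xi> \<in> L'" for \<xi>
    proof -
      obtain v where v: "v \<in> sperp A" "\<xi> = qcls A v"
        using \<xi> L'(1) by (auto simp: qsubspace_def qspace_def)
      obtain p m a where pma: "p \<in> P" "m \<in> sperp A" "a \<in> A" "s * hform m \<le> 0" "v = p + m + a"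
        using decomposition[OF v(1)] by blast
      \<comment> \<open>Subtracting the \<open>P\<close> component inside \<open>L'\<close> leaves
        the class of \<open>m\<close>, which is therefore subject to the definiteness of
        \<open>L'\<close>.\<close>
      have "qadd A \<xi> (qscale A (- 1) (qcls A p)) \<in> L'"
        using L'(1,3) \<xi> pma(1) unfolding qsubspace_def by blast
      also have "qadd A \<xi> (qscale A (- 1) (qcls A p)) = qcls A m"
        by (simp add: v(2) qscale_qcls qadd_qcls qcls_eq_iff pma(3,5))
      finally have "qcls A m = A"
        using L'(2) pma(2,4) by (metis qpos_qcls linorder_not_less)
      then have "m \<in> A"
        by (simp add: qcls_eq_A_iff)
      then have "qcls A v = qcls A p"
        using pma(3) psubspace_add[OF sub] by (simp add: qcls_eq_iff pma(5) add.assoc)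
      then show ?thesis
        using v(2) pma(1) by simp
    qed
    then show "L' = qcls A ` P"
      using L'(3) by blast
  qed
qed

lemma Npos_in_Wplus:
  assumes z: "cmod z < 1"
  shows "qcls A ` Npos A z \<in> Wplus A"
proof -
  have z2: "(cmod z)\<^sup>2 < 1"
    using z by (simp add: power_less_one_iff)
  have "\<exists>p m a. p \<in> Npos A z \<and> m \<in> sperp A \<and> a \<in> A \<and> 1 * hform m \<le> 0 \<and> v = p + m + a"
    if v: "v \<in> sperp A" for v
  proof -
    obtain p m a where pma: "p \<in> Npos A z" "m \<in> Nneg A (cnj z)" "a \<in> A" "v = p + m + a"
      using sperp_decomposition[OF z v] .
    have "hform m \<le> 0"
      using hform_Nneg[OF pma(2)] z2 by (simp add: mult_le_0_iff)
    moreover have "m \<in> sperp A"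
      using pma(2) by (simp add: in_Nneg_iff)
    ultimately show ?thesis
      using pma unfolding mult_1 by blast
  qed
  note decomposition = this
  have props: "Npos A z \<subseteq> sperp A" "closed {p + a |p a. p \<in> Npos A z \<and> a \<in> A}"
    "0 < (1 - (cmod z)\<^sup>2) / 2"
    using z2 unfolding Npos_plus_A[OF z] by (auto simp: closed_sperp Npos_def)
  have bound: "(1 - (cmod z)\<^sup>2) / 2 * (norm p)\<^sup>2 \<le> 1 * hform p" if "p \<in> Npos A z" for p
    using hform_Npos_ge[OF z that] by simp
  note max = maximal_definite[OF psubspace_Npos props bound decomposition, unfolded mult_1]
  show ?thesis
    unfolding Wplus_def mem_Collect_eq by (intro conjI) (rule max; assumption)+
qed

lemma Nneg_in_Wminus:
  assumes z: "cmod z < 1"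
  shows "qcls A ` Nneg A z \<in> Wminus A"
proof -
  have z2: "(cmod z)\<^sup>2 < 1"
    using z by (simp add: power_less_one_iff)
  have "\<exists>m p a. m \<in> Nneg A z \<and> p \<in> sperp A \<and> a \<in> A \<and> - 1 * hform p \<le> 0 \<and> v = m + p + a"
    if v: "v \<in> sperp A" for v
  proof -
    obtain p m a where pma: "p \<in> Npos A (cnj z)" "m \<in> Nneg A z" "a \<in> A" "v = p + m + a"
      using sperp_decomposition[of "cnj z", OF _ v] z unfolding complex_mod_cnj complex_cnj_cnj .
    have "- 1 * hform p \<le> 0"
      using hform_Npos[OF pma(1)] z2 by simp
    moreover have "p \<in> sperp A" "v = m + p + a"
      using pma(1,4) by (simp_all add: in_Npos_iff add.commute)
    ultimately show ?thesis
      using pma(2,3) by blast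
  qed
  note decomposition = this
  have props: "Nneg A z \<subseteq> sperp A" "closed {p + a |p a. p \<in> Nneg A z \<and> a \<in> A}"
    "0 < (1 - (cmod z)\<^sup>2) / 2"
    using z2 unfolding Nneg_plus_A[OF z] by (auto simp: closed_sperp Nneg_def)
  have bound: "(1 - (cmod z)\<^sup>2) / 2 * (norm p)\<^sup>2 \<le> - 1 * hform p" if "p \<in> Nneg A z" for p
    using hform_Nneg_le[OF z that] by simp
  have "qneg \<xi> = - 1 * qpos \<xi>" for \<xi> :: "('a \<times> 'a) set"
    by (simp add: qneg_def qpos_def)
  note max = maximal_definite[OF psubspace_Nneg props bound decomposition, folded this]
  show ?thesis
    unfolding Wminus_def mem_Collect_eq by (intro conjI) (rule max; assumption)+
qed

text \<open>This is \<open>Nneg_plus_A\<close> at \<open>cnj z\<close>, read modulo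
  \<open>A\<close>.\<close>

lemma qperp_Npos:
  assumes z: "cmod z < 1"
  shows "qperp A (qcls A ` Npos A z) = qcls A ` Nneg A (cnj z)"
proof
  show "qcls A ` Nneg A (cnj z) \<subseteq> qperp A (qcls A ` Npos A z)"
  proof
    fix \<eta> assume "\<eta> \<in> qcls A ` Nneg A (cnj z)"
    then obtain m where m: "m \<in> Nneg A (cnj z)" "\<eta> = qcls A m"
      by blast
    have "symp m p = 0" if "p \<in> Npos A z" for p
      using symp_Npos_Nneg[OF that m(1)] by (simp only: symp_eq_0_commute[of m])
    then show "\<eta> \<in> qperp A (qcls A ` Npos A z)"
      using m by (simp add: qperp_def qcls_in_qspace in_Nneg_iff in_Npos_iff qsymp_qcls)
  qed
  show "qperp A (qcls A ` Npos A z) \<subseteq> qcls A ` Nneg A (cnj z)"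
  proof
    fix \<eta> assume \<eta>: "\<eta> \<in> qperp A (qcls A ` Npos A z)"
    then obtain v where v: "v \<in> sperp A" "\<eta> = qcls A v"
      by (auto simp: qperp_def qspace_def)
    have "symp v p = 0" if "p \<in> Npos A z" for p
      using \<eta> v that by (auto simp: qperp_def in_Npos_iff qsymp_qcls)
    then have "v \<in> sperp (A \<union> Npos A (cnj (cnj z)))"
      using v(1) by (auto simp: sperp_def)
    then have "v \<in> {m + a |m a. m \<in> Nneg A (cnj z) \<and> a \<in> A}"
      using Nneg_plus_A[of "cnj z"] z by simp
    then obtain m a where "m \<in> Nneg A (cnj z)" "a \<in> A" "v = m + a"
      by blast
    then show "\<eta> \<in> qcls A ` Nneg A (cnj z)"
      using v(2) by (intro image_eqI[of _ _ m]) (simp_all add: qcls_eq_iff)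
  qed
qed

end

section \<open>Resolvents of contractions\<close>

definition resolvent :: "('a::complex_inner \<Rightarrow> 'a) \<Rightarrow> complex \<Rightarrow> 'a \<Rightarrow> 'a" where
  "resolvent R z g = (THE x. x - cscale z (R x) = g)"

lemma clinear_add: "clinear f \<Longrightarrow> f (x + y) = f x + f y"
  and clinear_cscale: "clinear f \<Longrightarrow> f (cscale c x) = cscale c (f x)"
  by (simp_all add: clinear_def)

lemma clinear_0: "clinear f \<Longrightarrow> f 0 = 0"
  using clinear_add[of f 0 0] by simp

lemma clinear_diff: "clinear f \<Longrightarrow> f (x - y) = f x - f y"
  using clinear_add[of f "x - y" y] by simp

lemma clinear_minus: "clinear f \<Longrightarrow> f (- x) = - f x"
  using clinear_diff[of f 0 x] clinear_0[of f] by simp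

lemmas clinear_simps = clinear_add clinear_cscale clinear_0 clinear_diff clinear_minus

locale linear_contraction =
  fixes R :: "'a::chilbert \<Rightarrow> 'a"
  assumes lin: "clinear R" and norm_le: "norm (R x) \<le> norm x"
begin

text \<open>Adding \<open>g\<close> to z R x gives a map with Lipschitz constant |z|, whose fixed
  point is the solution; it needs only that R is a contraction in the weak sense.\<close>

lemma resolvent_ex1:
  assumes z: "cmod z < 1"
  shows "\<exists>!x. x - cscale z (R x) = g"
proof -
  have "\<exists>!x. g + cscale z (R x) = x"
  proof (rule banach_fix_type[of "cmod z"])
    show "\<forall>x y. dist (g + cscale z (R x)) (g + cscale z (R y)) \<le> cmod z * dist x y"
    proof (intro allI)
      fix x y
      have "dist (g + cscale z (R x)) (g + cscale z (R y)) = cmod z * norm (R (x - y))"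
        by (simp add: dist_norm norm_cscale clinear_diff[OF lin] flip: cscale_diff_right)
      also have "\<dots> \<le> cmod z * dist x y"
        using norm_le[of "x - y"] by (simp add: dist_norm mult_left_mono)
      finally show "dist (g + cscale z (R x)) (g + cscale z (R y)) \<le> cmod z * dist x y" .
    qed
  qed (use z in auto)
  moreover have "g + cscale z (R x) = x \<longleftrightarrow> x - cscale z (R x) = g" for x
    by (auto simp: algebra_simps)
  ultimately show ?thesis
    by simp
qed

lemma resolvent_eq: "cmod z < 1 \<Longrightarrow> resolvent R z g - cscale z (R (resolvent R z g)) = g"
  unfolding resolvent_def by (rule theI'[OF resolvent_ex1])

lemma resolvent_unique:
  assumes "cmod z < 1" "x - cscale z (R x) = g"
  shows "resolvent R z g = x"
  using resolvent_ex1[OF assms(1)] resolvent_eq[OF assms(1)] assms(2) by blast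

lemma clinear_resolvent:
  assumes z: "cmod z < 1"
  shows "clinear (resolvent R z)"
  unfolding clinear_def
proof (intro conjI allI)
  fix g h c
  have "(resolvent R z g - cscale z (R (resolvent R z g)))
      + (resolvent R z h - cscale z (R (resolvent R z h))) = g + h"
    by (simp only: resolvent_eq[OF z])
  then show "resolvent R z (g + h) = resolvent R z g + resolvent R z h"
    by (intro resolvent_unique[OF z]) (simp add: clinear_simps[OF lin] cscale_simps add_diff_add)
  have "cscale c (resolvent R z g - cscale z (R (resolvent R z g))) = cscale c g"
    by (simp only: resolvent_eq[OF z])
  then show "resolvent R z (cscale c g) = cscale c (resolvent R z g)"
    by (intro resolvent_unique[OF z]) (simp add: clinear_simps[OF lin] cscale_simps mult.commute)
qed

text \<open>The operator 1 - zR shrinks norms by at most the factor 1 - |z|.\<close>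

lemma norm_resolvent_le:
  assumes z: "cmod z < 1"
  shows "norm (resolvent R z g) \<le> norm g / (1 - cmod z)"
proof -
  let ?x = "resolvent R z g"
  have "norm ?x - cmod z * norm ?x \<le> norm ?x - norm (cscale z (R ?x))"
    using norm_le[of ?x] by (simp add: norm_cscale mult_left_mono)
  also have "\<dots> \<le> norm (?x - cscale z (R ?x))"
    by (rule norm_triangle_ineq2)
  finally have "norm ?x * (1 - cmod z) \<le> norm g"
    by (simp add: resolvent_eq[OF z] algebra_simps)
  then show ?thesis
    using z by (simp add: pos_le_divide_eq)
qed

text \<open>The second-order Taylor remainder: \<open>(1 - zR)\<close> maps it to \<open>(z - w)\<^sup>2 R x'\<close>.\<close>

lemma norm_resolvent_remainder_le:
  fixes g :: 'a
  assumes z: "cmod z < 1" and w: "cmod w < 1"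
  defines "x' \<equiv> resolvent R w (R (resolvent R w g))"
  shows "norm (resolvent R z g - resolvent R w g - cscale (z - w) x')
    \<le> (cmod (z - w))\<^sup>2 * norm x' / (1 - cmod z)"
proof -
  let ?x = "resolvent R w g"
  have eqs: "resolvent R z g - cscale z (R (resolvent R z g)) = g"
    "?x - cscale w (R ?x) = g" "x' - cscale w (R x') = R ?x"
    using resolvent_eq[OF z, of g] resolvent_eq[OF w, of g] resolvent_eq[OF w, of "R ?x"]
    by (simp_all add: x'_def)
  define h where "h = z - w"
  then have zh: "z = w + h"
    by simp
  define d where "d = resolvent R z g - ?x - cscale h x'"
  have "d - cscale z (R d) = (resolvent R z g - cscale z (R (resolvent R z g)))
      - (?x - cscale w (R ?x)) + cscale h (R ?x - (x' - cscale w (R x')))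
      + cscale (h * h) (R x')"
    by (simp add: d_def zh clinear_simps[OF lin] cscale_simps algebra_simps)
  also have "\<dots> = cscale (h * h) (R x')"
    unfolding eqs by simp
  finally have "resolvent R z (cscale (h * h) (R x')) = d"
    by (rule resolvent_unique[OF z])
  then have "norm d \<le> norm (cscale (h * h) (R x')) / (1 - cmod z)"
    using norm_resolvent_le[OF z] by metis
  also have "norm (cscale (h * h) (R x')) = (cmod (z - w))\<^sup>2 * norm (R x')"
    by (simp add: norm_cscale norm_mult power2_eq_square h_def)
  also have "(cmod (z - w))\<^sup>2 * norm (R x') / (1 - cmod z)
      \<le> (cmod (z - w))\<^sup>2 * norm x' / (1 - cmod z)"
    using z norm_le[of x'] by (intro divide_right_mono mult_left_mono) auto
  finally show ?thesis
    by (simp add: d_def h_def)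
qed

text \<open>The vector \<open>v + graph_map z v\<close> is the point of the plane \<open>{(x, z x)}\<close> that differs from
\<open>v\<close> by an element of the graph \<open>{(R b, b)}\<close>.\<close>

definition graph_map :: "complex \<Rightarrow> 'a \<times> 'a \<Rightarrow> 'a \<times> 'a" where
  "graph_map z v = (let b = cscale z (resolvent R z (fst v - R (snd v))) - snd v in (R b, b))"

text \<open>The formal derivative in z: that of z x is x + z x', and the derivative of the resolvent
  (1 - zR)^(-1) g is (1 - zR)^(-1) R (1 - zR)^(-1) g.\<close>

definition graph_map_deriv :: "complex \<Rightarrow> 'a \<times> 'a \<Rightarrow> 'a \<times> 'a" where
  "graph_map_deriv z v = (let x = resolvent R z (fst v - R (snd v));
    b = x + cscale z (resolvent R z (R x)) in (R b, b))"

lemma graph_map_mem: "fst (graph_map z v) = R (snd (graph_map z v))"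
  and graph_map_deriv_mem: "fst (graph_map_deriv z v) = R (snd (graph_map_deriv z v))"
  by (simp_all add: graph_map_def graph_map_deriv_def Let_def)

lemma graph_map_plus:
  assumes "cmod z < 1"
  shows "v + graph_map z v = (resolvent R z (fst v - R (snd v)),
    cscale z (resolvent R z (fst v - R (snd v))))"
  using resolvent_eq[OF assms, of "fst v - R (snd v)"]
  by (simp add: graph_map_def Let_def prod_eq_iff clinear_simps[OF lin] algebra_simps)

lemma graph_map_add:
  assumes "cmod z < 1"
  shows "graph_map z (v + w) = graph_map z v + graph_map z w"
proof -
  have "fst (v + w) - R (snd (v + w)) = (fst v - R (snd v)) + (fst w - R (snd w))"
    by (simp add: clinear_simps[OF lin])
  then show ?thesis
    unfolding graph_map_def Let_def
    by (simp only: clinear_add[OF clinear_resolvent[OF assms]])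
      (simp add: prod_eq_iff clinear_simps[OF lin] cscale_simps)
qed

lemma graph_map_pscale:
  assumes "cmod z < 1"
  shows "graph_map z (pscale c v) = pscale c (graph_map z v)"
proof -
  have "fst (pscale c v) - R (snd (pscale c v)) = cscale c (fst v - R (snd v))"
    by (simp add: clinear_simps[OF lin] cscale_simps)
  then show ?thesis
    unfolding graph_map_def Let_def
    by (simp only: clinear_cscale[OF clinear_resolvent[OF assms]])
      (simp add: prod_eq_iff clinear_simps[OF lin] cscale_simps mult.commute)
qed

text \<open>Elements of \<open>A\<close> have this form, so the map preserves \<open>A\<close> and
  passes to classes.\<close>

lemma graph_map_eq_minus:
  assumes "cmod z < 1" "fst v = R (snd v)"
  shows "graph_map z v = - v"
  using assms(2) clinear_0[OF clinear_resolvent[OF assms(1)]]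
  by (simp add: graph_map_def Let_def prod_eq_iff clinear_simps[OF lin])

lemma graph_map_deriv_cong:
  assumes "fst a = R (snd a)"
  shows "graph_map_deriv z (v + a) = graph_map_deriv z v"
proof -
  have "fst (v + a) - R (snd (v + a)) = fst v - R (snd v)"
    by (simp add: assms clinear_simps[OF lin])
  then show ?thesis
    by (simp only: graph_map_deriv_def)
qed

text \<open>Origin of the constant, with \<rho> = 1 - |w|: \<open>g\<close> costs a factor 2, two
  resolvents at w cost 1/\<rho> each, \<open>near\<close> replaces the resolvent bound at z by
  2/\<rho>, and 2/\<rho> + 1 is at most 3/\<rho>. This bounds \<open>b\<close> with 6, and the pair
  \<open>(R b, b)\<close> doubles it to 12.\<close>

lemma graph_map_remainder_le:
  assumes z: "cmod z < 1" and w: "cmod w < 1" and near: "1 - cmod w \<le> 2 * (1 - cmod z)"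
  shows "norm (graph_map z v - graph_map w v - pscale (z - w) (graph_map_deriv w v))
    \<le> 12 * (cmod (z - w))\<^sup>2 / (1 - cmod w) ^ 3 * norm v"
proof -
  define \<rho> where "\<rho> = 1 - cmod w"
  have \<rho>: "0 < \<rho>" "\<rho> \<le> 1"
    using w by (simp_all add: \<rho>_def)
  define g x x' where "g = fst v - R (snd v)" and "x = resolvent R w g"
    and "x' = resolvent R w (R x)"
  define h where "h = z - w"
  then have zh: "z = w + h"
    by simp
  define d where "d = resolvent R z g - x - cscale h x'"
  \<comment> \<open>The second coordinate of the remainder: inserting the first-order expansion of
    the resolvent at z into z times the resolvent leaves z d and the quadratic term in h.\<close>
  define b where "b = cscale z d + cscale (h * h) x'"
  have eq: "graph_map z v - graph_map w v - pscale (z - w) (graph_map_deriv w v) = (R b, b)"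
    unfolding h_def[symmetric]
    by (simp add: graph_map_def graph_map_deriv_def Let_def prod_eq_iff b_def d_def x'_def x_def g_def zh
        clinear_simps[OF lin] cscale_simps algebra_simps)
  have "norm g \<le> norm (fst v) + norm (snd v)"
    unfolding g_def using norm_triangle_ineq4[of "fst v" "R (snd v)"] norm_le[of "snd v"] by linarith
  also have "\<dots> \<le> 2 * norm v"
    using norm_fst_le[of "fst v" "snd v"] norm_snd_le[of "snd v" "fst v"] by simp
  finally have g: "norm g \<le> 2 * norm v" .
  have x: "norm x \<le> norm g / \<rho>"
    unfolding x_def \<rho>_def by (rule norm_resolvent_le[OF w])
  have "norm x' \<le> norm (R x) / \<rho>"
    unfolding x'_def \<rho>_def by (rule norm_resolvent_le[OF w])
  also have "\<dots> \<le> 2 * norm v / \<rho> / \<rho>"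
    using order_trans[OF norm_le order_trans[OF x divide_right_mono[OF g]]] \<rho>
    by (intro divide_right_mono) auto
  finally have x': "norm x' \<le> 2 * norm v / \<rho>\<^sup>2"
    by (simp add: power2_eq_square)
  have "norm d \<le> (cmod (z - w))\<^sup>2 * norm x' / (1 - cmod z)"
    unfolding d_def x'_def x_def h_def by (rule norm_resolvent_remainder_le[OF z w])
  also have "\<dots> \<le> (cmod (z - w))\<^sup>2 * norm x' / (\<rho> / 2)"
    using near \<rho> by (intro divide_left_mono) (auto simp: \<rho>_def)
  finally have d: "norm d \<le> (cmod (z - w))\<^sup>2 * norm x' * (2 / \<rho>)"
    by simp
  have "norm b \<le> cmod z * norm d + (cmod (z - w))\<^sup>2 * norm x'"
    unfolding b_def by (rule order_trans[OF norm_triangle_ineq])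
      (simp add: norm_cscale norm_mult power2_eq_square h_def)
  also have "\<dots> \<le> norm d + (cmod (z - w))\<^sup>2 * norm x'"
    using z by (simp add: mult_left_le_one_le)
  also have "\<dots> \<le> (cmod (z - w))\<^sup>2 * norm x' * (2 / \<rho> + 1)"
    using d by (simp add: distrib_left)
  also have "\<dots> \<le> (cmod (z - w))\<^sup>2 * (2 * norm v / \<rho>\<^sup>2) * (3 / \<rho>)"
    using x' \<rho> by (intro mult_mono) (auto simp: field_simps)
  finally have b: "norm b \<le> 6 * (cmod (z - w))\<^sup>2 / \<rho> ^ 3 * norm v"
    by (simp add: power2_eq_square power3_eq_cube)
  have "norm (R b, b) \<le> norm (R b) + norm b"
    by (rule norm_Pair_le)
  also have "\<dots> \<le> 2 * norm b"
    using norm_le[of b] by simp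
  finally show ?thesis
    using b unfolding eq \<rho>_def by simp
qed

lemma graph_map_complex_differentiable:
  assumes w: "cmod w < 1" and \<epsilon>: "0 < \<epsilon>"
  obtains \<delta> where "0 < \<delta>" "\<And>z v. cmod z < 1 \<Longrightarrow> cmod (z - w) < \<delta> \<Longrightarrow>
      norm (graph_map z v - graph_map w v - pscale (z - w) (graph_map_deriv w v))
      \<le> \<epsilon> * cmod (z - w) * norm v"
proof
  define \<rho> where "\<rho> = 1 - cmod w"
  have \<rho>: "0 < \<rho>"
    using w by (simp add: \<rho>_def)
  \<comment> \<open>The first bound yields the hypothesis \<open>near\<close> of
    \<open>graph_map_remainder_le\<close>; the second absorbs its constant into \<epsilon>.\<close>
  define \<delta> where "\<delta> = min (\<rho> / 2) (\<epsilon> * \<rho> ^ 3 / 12)"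
  show "0 < \<delta>"
    using \<rho> \<epsilon> by (simp add: \<delta>_def)
  fix z and v :: "'a \<times> 'a" assume z: "cmod z < 1" "cmod (z - w) < \<delta>"
  have "cmod z - cmod w \<le> cmod (z - w)"
    by (rule norm_triangle_ineq2)
  then have near: "1 - cmod w \<le> 2 * (1 - cmod z)"
    using z(2) unfolding \<delta>_def \<rho>_def by (simp add: min_less_iff_conj)
  have "12 * cmod (z - w) \<le> \<epsilon> * \<rho> ^ 3"
    using z(2) by (simp add: \<delta>_def)
  then have "12 * (cmod (z - w))\<^sup>2 / \<rho> ^ 3 \<le> \<epsilon> * cmod (z - w)"
    using \<rho> mult_right_mono[of "12 * cmod (z - w)" "\<epsilon> * \<rho> ^ 3" "cmod (z - w)"]
    by (simp add: pos_divide_le_eq power2_eq_square mult_ac)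
  then have "12 * (cmod (z - w))\<^sup>2 / \<rho> ^ 3 * norm v \<le> \<epsilon> * cmod (z - w) * norm v"
    by (intro mult_right_mono) auto
  then show "norm (graph_map z v - graph_map w v - pscale (z - w) (graph_map_deriv w v))
      \<le> \<epsilon> * cmod (z - w) * norm v"
    using graph_map_remainder_le[OF z(1) w near, of v] unfolding \<rho>_def by linarith
qed

end

section \<open>Graph coordinates\<close>

definition graph_of :: "('a \<Rightarrow> 'a) \<Rightarrow> ('a \<times> 'a) set" where
  "graph_of S = {v. snd v = S (fst v)}"

definition cograph_of :: "('a \<Rightarrow> 'a) \<Rightarrow> ('a \<times> 'a) set" where
  "cograph_of R = {v. fst v = R (snd v)}"

lemma graph_of_swap: "graph_of R = prod.swap ` cograph_of R"
  by (rule set_eqI) (simp add: in_swap_image_iff graph_of_def cograph_of_def)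

text \<open>\<open>A_S\<close> and \<open>A_R\<close> make S and R mutually inverse on the
  coordinates of \<open>A\<close>, where isotropy forces them to be isometric. This is why
  \<open>coercive\<close> asks for strictness only orthogonally to the first coordinates of
  \<open>A\<close>.\<close>

locale contraction_pair = isotropic A + S: linear_contraction S + R: linear_contraction R
  for A :: "('a::chilbert \<times> 'a) set" and S R :: "'a \<Rightarrow> 'a" +
  fixes c :: real
  assumes adj: "cinner (S x) y = cinner x (R y)"
    and A_S: "A \<subseteq> graph_of S"
    and A_R: "A \<subseteq> cograph_of R"
    and c: "0 < c" "c < 1"
    and coercive: "(\<And>a. a \<in> A \<Longrightarrow> cinner y (fst a) = 0) \<Longrightarrow> (norm (S y))\<^sup>2 \<le> (1 - c) * (norm y)\<^sup>2"
begin

lemma snd_A: "a \<in> A \<Longrightarrow> snd a = S (fst a)"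
  and fst_A: "a \<in> A \<Longrightarrow> fst a = R (snd a)"
  using A_S A_R by (auto simp: graph_of_def cograph_of_def)

lemma adj': "cinner (R x) y = cinner x (S y)"
  using adj[of y x] cinner_cnj[of "R x" y] cinner_cnj[of x "S y"] by simp

lemma symp_graph_cograph: "v \<in> graph_of S \<Longrightarrow> w \<in> cograph_of R \<Longrightarrow> symp v w = 0"
  by (simp add: symp_eq_0_iff graph_of_def cograph_of_def adj)

lemma graph_subset_sperp: "graph_of S \<subseteq> sperp A"
  using symp_graph_cograph A_R unfolding sperp_def by blast

lemma cograph_subset_sperp: "cograph_of R \<subseteq> sperp A"
  using symp_graph_cograph A_S symp_eq_0_commute unfolding sperp_def by blast

lemma coercive_sqrt:
  assumes "\<And>a. a \<in> A \<Longrightarrow> cinner y (fst a) = 0"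
  shows "norm (S y) \<le> sqrt (1 - c) * norm y"
proof (rule power2_le_imp_le)
  show "(norm (S y))\<^sup>2 \<le> (sqrt (1 - c) * norm y)\<^sup>2"
    using coercive[OF assms] c by (simp add: power_mult_distrib)
qed (use c in simp)

text \<open>Everything except coercivity of R is symmetric. For y orthogonal to the second
  coordinates of \<open>A\<close>, R y is orthogonal to the first ones, and the squared norm of R y
  is the inner product of y with S R y; Cauchy-Schwarz and the bound for S at R y give the same
  constant.\<close>

lemma swap: "contraction_pair (prod.swap ` A) R S c"
proof
  show "psubspace (prod.swap ` A)"
    by (rule psubspace_swap[OF sub])
  have "prod.swap ` A = prod.swap -` A"
    by (rule set_eqI) (simp add: in_swap_image_iff)
  then show "closed (prod.swap ` A)"
    using closed_A by (simp add: closed_vimage continuous_on_swap)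
  show "prod.swap ` A \<subseteq> sperp (prod.swap ` A)"
    using iso by (auto simp: sperp_swap)
  show "cinner (R x) y = cinner x (S y)" for x y
    by (rule adj')
  show "prod.swap ` A \<subseteq> graph_of R" "prod.swap ` A \<subseteq> cograph_of S"
    using fst_A snd_A by (auto simp: graph_of_def cograph_of_def)
  show "(norm (R y))\<^sup>2 \<le> (1 - c) * (norm y)\<^sup>2"
    if y: "\<And>a. a \<in> prod.swap ` A \<Longrightarrow> cinner y (fst a) = 0" for y
  proof -
    have "cinner (R y) (fst a) = 0" if a: "a \<in> A" for a
      using y[of "prod.swap a"] a snd_A[OF a] by (simp add: adj')
    then have "norm (S (R y)) \<le> sqrt (1 - c) * norm (R y)"
      by (rule coercive_sqrt)
    then have "norm y * norm (S (R y)) \<le> norm y * (sqrt (1 - c) * norm (R y))"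
      by (intro mult_left_mono) auto
    moreover have "(norm (R y))\<^sup>2 \<le> norm y * norm (S (R y))"
      using cinner_Cauchy_Schwarz[of y "S (R y)"]
      by (simp flip: adj') (simp add: cinner_norm norm_power)
    ultimately have "norm (R y) * norm (R y) \<le> sqrt (1 - c) * norm y * norm (R y)"
      by (simp add: power2_eq_square mult_ac)
    then have "norm (R y) \<le> sqrt (1 - c) * norm y"
      using c by (cases "R y = 0") auto
    then have "(norm (R y))\<^sup>2 \<le> (sqrt (1 - c) * norm y)\<^sup>2"
      by (intro power_mono) auto
    then show ?thesis
      using c by (simp add: power_mult_distrib)
  qed
qed (use c in auto)

text \<open>The map sending y to g + R S y preserves the complement of the first coordinates of
  \<open>A\<close>, because R S is self-adjoint and fixes those coordinates. Coercivity makes it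
  contract there, so Banach's theorem applies.\<close>

lemma solve_defect:
  assumes g: "\<And>a. a \<in> A \<Longrightarrow> cinner g (fst a) = 0"
  obtains y where "\<And>a. a \<in> A \<Longrightarrow> cinner y (fst a) = 0" "y - R (S y) = g"
proof -
  let ?K = "{y. \<forall>u\<in>fst ` A. cinner y u = 0}"
  have "\<exists>!y. y \<in> ?K \<and> g + R (S y) = y"
  proof (rule Banach_fix[of ?K "1 - c" "\<lambda>y. g + R (S y)"])
    show "complete ?K"
      unfolding complete_eq_closed by (rule closed_orthogonal_complement)
    show "?K \<noteq> {}"
      by (auto intro!: exI[of _ 0])
    show "(\<lambda>y. g + R (S y)) ` ?K \<subseteq> ?K"
    proof clarsimp
      fix y a b assume y: "\<forall>x\<in>A. cinner y (fst x) = 0" and a: "(a, b) \<in> A"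
      have "cinner (R (S y)) a = cinner y (R (S a))"
        by (simp add: adj adj')
      also have "R (S a) = a"
        using fst_A[OF a] snd_A[OF a] by simp
      finally show "cinner (g + R (S y)) a = 0"
        using y g a by (force simp: cinner_simps)
    qed
    show "dist (g + R (S x)) (g + R (S y)) \<le> (1 - c) * dist x y" if "x \<in> ?K" "y \<in> ?K" for x y
    proof -
      let ?w = "x - y" and ?u = "R (S (x - y))"
      have w: "cinner ?w (fst a) = 0" if "a \<in> A" for a
        using \<open>x \<in> ?K\<close> \<open>y \<in> ?K\<close> that by (simp add: cinner_simps)
      have u: "cinner ?u (fst a) = 0" if a: "a \<in> A" for a
      proof -
        have "cinner ?u (fst a) = cinner ?w (R (S (fst a)))"
          by (simp add: adj adj')
        also have "R (S (fst a)) = fst a"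
          using fst_A[OF a] snd_A[OF a] by simp
        finally show ?thesis
          using w[OF a] by simp
      qed
      \<comment> \<open>Moving R across gives the inner product of S w with S u, so the square-root
        bound enters twice and yields the factor 1 - c.\<close>
      have "(norm ?u)\<^sup>2 = cmod (cinner (S ?w) (S ?u))"
        by (simp add: adj' [symmetric] cinner_norm norm_power)
      also have "\<dots> \<le> norm (S ?w) * norm (S ?u)"
        by (rule cinner_Cauchy_Schwarz)
      also have "\<dots> \<le> (sqrt (1 - c) * norm ?w) * (sqrt (1 - c) * norm ?u)"
        using c by (intro mult_mono coercive_sqrt w u) auto
      also have "\<dots> = (1 - c) * norm ?w * norm ?u"
        using c by simp
      finally have "norm ?u \<le> (1 - c) * norm ?w"
        using c by (cases "?u = 0") (auto simp: power2_eq_square)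
      then show ?thesis
        by (simp add: dist_norm clinear_simps[OF S.lin] clinear_simps[OF R.lin])
    qed
  qed (use c in auto)
  then obtain y where "y \<in> ?K" "g + R (S y) = y"
    by blast
  then show thesis
    by (intro that[of y]) (auto simp: algebra_simps)
qed

text \<open>The first coordinate y of the graph part must solve y - R S y =
  \<open>fst v - R (snd v)\<close>. The right side is orthogonal to the first coordinates of
  \<open>A\<close> exactly because \<open>v\<close> lies in \<open>sperp A\<close>, so
  \<open>solve_defect\<close> applies.\<close>

lemma sperp_graph_decomposition:
  assumes v: "v \<in> sperp A"
  obtains p m where "p \<in> graph_of S" "m \<in> cograph_of R" "v = p + m"
proof -
  have "cinner (fst v - R (snd v)) (fst a) = 0" if a: "a \<in> A" for a
  proof -
    have "cinner (fst v) (fst a) = cinner (snd v) (snd a)"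
      using v a by (simp add: sperp_def symp_eq_0_iff)
    then show ?thesis
      using snd_A[OF a] by (simp add: cinner_simps adj')
  qed
  then obtain y where y: "y - R (S y) = fst v - R (snd v)"
    by (rule solve_defect)
  show thesis
  proof
    show "(y, S y) \<in> graph_of S"
      by (simp add: graph_of_def)
    show "v - (y, S y) \<in> cograph_of R"
      using y by (simp add: cograph_of_def clinear_simps[OF R.lin] algebra_simps)
    show "v = (y, S y) + (v - (y, S y))"
      by simp
  qed
qed

lemma graph_map_in_cograph: "R.graph_map z v \<in> cograph_of R"
  and graph_map_deriv_in_cograph: "R.graph_map_deriv z v \<in> cograph_of R"
  using R.graph_map_mem R.graph_map_deriv_mem by (simp_all add: cograph_of_def)

text \<open>The expression \<open>fst w - R (snd w)\<close> vanishes on the cograph, so it is the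
  same for \<open>w\<close> and its graph part \<open>p\<close>. For a point (x, z x) it equals (1 -
  zR) x, so \<open>p\<close> determines x through the resolvent.\<close>

lemma Npos_eq_graph:
  assumes z: "cmod z < 1"
  shows "Npos A z = {v + R.graph_map z v |v. v \<in> graph_of S}"
proof
  show "{v + R.graph_map z v |v. v \<in> graph_of S} \<subseteq> Npos A z"
  proof
    fix w assume "w \<in> {v + R.graph_map z v |v. v \<in> graph_of S}"
    then obtain v where v: "v \<in> graph_of S" "w = v + R.graph_map z v"
      by blast
    then have "w \<in> sperp A"
      using graph_subset_sperp cograph_subset_sperp graph_map_in_cograph
        psubspace_add[OF psubspace_sperp] by blast
    then show "w \<in> Npos A z"
      using v(2) by (simp add: in_Npos_iff R.graph_map_plus[OF z])
  qed
  show "Npos A z \<subseteq> {v + R.graph_map z v |v. v \<in> graph_of S}"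
  proof
    fix w assume w: "w \<in> Npos A z"
    then have "w \<in> sperp A" "snd w = cscale z (fst w)"
      by (simp_all add: in_Npos_iff)
    from this(1) obtain p m where pm: "p \<in> graph_of S" "m \<in> cograph_of R" "w = p + m"
      by (rule sperp_graph_decomposition)
    have "fst w - R (snd w) = fst p - R (snd p)"
      using pm(2,3) by (simp add: cograph_of_def clinear_simps[OF R.lin])
    then have "resolvent R z (fst p - R (snd p)) = fst w"
      using \<open>snd w = cscale z (fst w)\<close>
      by (intro R.resolvent_unique[OF z]) (simp add: clinear_simps[OF R.lin])
    then have "w = p + R.graph_map z p"
      using \<open>snd w = cscale z (fst w)\<close> by (simp add: R.graph_map_plus[OF z] prod_eq_iff)
    then show "w \<in> {v + R.graph_map z v |v. v \<in> graph_of S}"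
      using pm(1) by blast
  qed
qed

text \<open>The source of strictness. With x the resolvent vector and y' the solution of the defect
  equation orthogonal to the first coordinates of \<open>A\<close>, the form h of \<open>v\<close>
  satisfies c |y'|^2 <= h <= |g| |y'|, and |g| <= 2 |x|. Hence c |y'| <= 2 |x|, and c h <= 4
  |x|^2.\<close>

lemma hform_graph_le:
  assumes v: "v \<in> graph_of S" and z: "cmod z < 1"
  shows "c / 4 * hform v \<le> (norm (resolvent R z (fst v - R (snd v))))\<^sup>2"
proof -
  define y g x where "y = fst v" and "g = y - R (S y)" and "x = resolvent R z g"
  have h: "hform (u, S u) = Re (cinner (u - R (S u)) u)" for u
    by (simp add: hform_def cinner_simps adj' Re_cinner_self)
  have "cinner g (fst a) = 0" if a: "a \<in> A" for a
  proof -
    have "R (S (fst a)) = fst a"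
      using fst_A[OF a] snd_A[OF a] by simp
    then show ?thesis
      by (simp add: g_def cinner_simps adj adj')
  qed
  \<comment> \<open>Replacing \<open>y\<close> by \<open>y'\<close> changes it by a kernel vector of
    1 - R S, which leaves the form unchanged but makes \<open>coercive\<close> applicable.\<close>
  then obtain y' where y': "\<And>a. a \<in> A \<Longrightarrow> cinner y' (fst a) = 0" "y' - R (S y') = g"
    using solve_defect by blast
  have "hform v = Re (cinner g y)"
    using v h[of y] by (simp add: graph_of_def y_def g_def prod_eq_iff) (metis prod.collapse)
  also have "cinner g y = cinner g y' + cinner y' ((y - y') - R (S (y - y')))"
    by (simp add: y'(2)[symmetric] cinner_simps adj adj' clinear_simps[OF S.lin] clinear_simps[OF R.lin])
  also have "(y - y') - R (S (y - y')) = 0"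
    using y'(2) by (simp add: g_def clinear_simps[OF S.lin] clinear_simps[OF R.lin] algebra_simps)
  finally have hv: "hform v = Re (cinner g y')"
    by simp
  have "c * (norm y')\<^sup>2 \<le> hform (y', S y')"
    using coercive[OF y'(1)] by (simp add: hform_def algebra_simps)
  also have "\<dots> = hform v"
    by (simp add: h y'(2) hv)
  finally have lower: "c * (norm y')\<^sup>2 \<le> hform v" .
  have "hform v \<le> norm g * norm y'"
    unfolding hv using complex_Re_le_cmod cinner_Cauchy_Schwarz order_trans by blast
  moreover have "norm g \<le> 2 * norm x"
  proof -
    have "norm g \<le> norm x + norm (cscale z (R x))"
      using norm_triangle_ineq4[of x "cscale z (R x)"] R.resolvent_eq[OF z, of g] by (simp add: x_def)
    moreover have "norm (cscale z (R x)) \<le> 1 * norm x"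
      unfolding norm_cscale using z R.norm_le by (intro mult_mono) auto
    ultimately show ?thesis by simp
  qed
  ultimately have upper: "hform v \<le> 2 * norm x * norm y'"
    using mult_right_mono[of "norm g" "2 * norm x" "norm y'"] by simp
  have "c * norm y' \<le> 2 * norm x"
    using order_trans[OF lower upper] by (cases "y' = 0") (auto simp: power2_eq_square)
  then have "2 * norm x * (c * norm y') \<le> 2 * norm x * (2 * norm x)"
    by (intro mult_left_mono) auto
  moreover have "c * hform v \<le> c * (2 * norm x * norm y')"
    using upper c by (intro mult_left_mono) auto
  ultimately have "c / 4 * hform v \<le> (norm x)\<^sup>2"
    by (simp add: power2_eq_square mult_ac)
  then show ?thesis
    using v by (simp add: x_def g_def y_def graph_of_def)
qed

text \<open>The vector \<open>v\<close> and its image are symplectically orthogonal, so their forms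
  add up to that of the plane point, which is 1 - |z|^2 times a squared norm.
  \<open>hform_graph_le\<close> bounds this below by \<kappa> times the form of
  \<open>v\<close>.\<close>

lemma hform_graph_map:
  assumes z: "cmod z < 1"
  obtains k where "k < 1" "\<And>v. v \<in> graph_of S \<Longrightarrow>
    sqrt (- hform (R.graph_map z v)) \<le> k * sqrt (hform v)"
proof
  define \<kappa> where "\<kappa> = (1 - (cmod z)\<^sup>2) * (c / 4)"
  have z2: "(cmod z)\<^sup>2 < 1"
    using z by (simp add: power_less_one_iff)
  then have "0 < \<kappa>"
    using c by (simp add: \<kappa>_def)
  then show "sqrt (1 - \<kappa>) < 1"
    by simp
  fix v assume v: "v \<in> graph_of S"
  have "hform v + hform (R.graph_map z v) = hform (v + R.graph_map z v)"
    by (rule hform_add[symmetric, OF symp_graph_cograph[OF v graph_map_in_cograph]])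
  also have "\<dots> = (1 - (cmod z)\<^sup>2) * (norm (fst (v + R.graph_map z v)))\<^sup>2"
    by (rule hform_Npos[of _ A]) (use v in \<open>unfold Npos_eq_graph[OF z], blast\<close>)
  also have "\<dots> \<ge> (1 - (cmod z)\<^sup>2) * (c / 4 * hform v)"
    using hform_graph_le[OF v z] z2 by (simp add: R.graph_map_plus[OF z] mult_left_mono)
  finally have "- hform (R.graph_map z v) \<le> (1 - \<kappa>) * hform v"
    by (simp add: \<kappa>_def algebra_simps)
  then show "sqrt (- hform (R.graph_map z v)) \<le> sqrt (1 - \<kappa>) * sqrt (hform v)"
    by (simp flip: real_sqrt_mult)
qed

end

section \<open>Operators induced on the quotient\<close>

definition induced :: "('a::complex_inner \<times> 'a) set \<Rightarrow> ('a \<times> 'a \<Rightarrow> 'a \<times> 'a) \<Rightarrow> ('a \<times> 'a) set \<Rightarrow> ('a \<times> 'a) set" where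
  "induced A f \<xi> = qcls A (f (qrep \<xi>))"

context isotropic
begin

lemma induced_qcls:
  assumes add: "\<And>v w. f (v + w) = f v + f w" and A: "\<And>a. a \<in> A \<Longrightarrow> f a \<in> A"
  shows "induced A f (qcls A v) = qcls A (f v)"
proof -
  have "f (qrep (qcls A v)) = f v + f (qrep (qcls A v) - v)"
    by (simp flip: add)
  then show ?thesis
    using A[OF qrep_qcls] by (simp add: induced_def qcls_eq_iff)
qed

lemma qstrict_contraction_induced:
  assumes add: "\<And>v w. f (v + w) = f v + f w" and scale: "\<And>c v. f (pscale c v) = pscale c (f v)"
    and A: "\<And>a. a \<in> A \<Longrightarrow> f a \<in> A" and maps: "\<And>v. v \<in> X \<Longrightarrow> f v \<in> Y"
    and k: "k < 1"
      "\<And>v. v \<in> X \<Longrightarrow> sqrt (qY (qcls A (f v))) \<le> k * sqrt (qX (qcls A v))"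
  shows "qstrict_contraction A (qcls A ` X) (qcls A ` Y) qX qY (induced A f)"
  unfolding qstrict_contraction_def
proof (intro conjI ballI allI)
  note ind = induced_qcls[of f, OF add A]
  show "induced A f \<xi> \<in> qcls A ` Y" if "\<xi> \<in> qcls A ` X" for \<xi>
    using that maps by (elim imageE) (simp add: ind)
  show "induced A f (qadd A \<xi> \<eta>) = qadd A (induced A f \<xi>) (induced A f \<eta>)"
    if "\<xi> \<in> qcls A ` X" "\<eta> \<in> qcls A ` X" for \<xi> \<eta>
    using that by (elim imageE) (simp add: ind qadd_qcls add)
  show "induced A f (qscale A c \<xi>) = qscale A c (induced A f \<xi>)"
    if "\<xi> \<in> qcls A ` X" for c \<xi>
    using that by (elim imageE) (simp add: ind qscale_qcls scale)
  show "\<exists>k<1. \<forall>\<xi>\<in>qcls A ` X. sqrt (qY (induced A f \<xi>)) \<le> k * sqrt (qX \<xi>)"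
    by (intro exI[of _ k] conjI k(1) ballI, elim imageE) (simp add: ind k(2))
qed

text \<open>Changing the representative of \<open>v\<close> changes the error vector only by an
  element of \<open>A\<close>. The pair estimate therefore bounds the quotient norm of one error by
  the norm of every representative, and the infimum may be taken.\<close>

lemma qholo_induced:
  assumes add: "\<And>z v w. z \<in> U \<Longrightarrow> F z (v + w) = F z v + F z w"
    and A: "\<And>z a. z \<in> U \<Longrightarrow> a \<in> A \<Longrightarrow> F z a \<in> A"
    and D: "\<And>z v. D z v \<in> sperp A" "\<And>z v a. a \<in> A \<Longrightarrow> D z (v + a) = D z v"
    and diff: "\<And>w \<epsilon>. w \<in> U \<Longrightarrow> 0 < \<epsilon> \<Longrightarrow> \<exists>\<delta>>0. \<forall>z\<in>U. cmod (z - w) < \<delta> \<longrightarrow>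
      (\<forall>v. norm (F z v - F w v - pscale (z - w) (D w v)) \<le> \<epsilon> * cmod (z - w) * norm v)"
  shows "qholo A (qcls A ` X) (\<lambda>z. induced A (F z)) U"
  unfolding qholo_def
proof
  fix w assume w: "w \<in> U"
  have ind_F: "induced A (F z) (qcls A v) = qcls A (F z v)" if "z \<in> U" for z v
    using add[OF that] A[OF that] by (rule induced_qcls)
  have ind_D: "induced A (D w) (qcls A v) = qcls A (D w v)" for v
    using D(2)[OF qrep_qcls[of v], where v = v and z = w] by (simp add: induced_def)
  have "\<exists>\<delta>>0. \<forall>z\<in>U. 0 < cmod (z - w) \<and> cmod (z - w) < \<delta> \<longrightarrow> (\<forall>\<xi>\<in>qcls A ` X.
      qnorm (qdiff A (qdiff A (induced A (F z) \<xi>) (induced A (F w) \<xi>))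
        (qscale A (z - w) (induced A (D w) \<xi>))) \<le> \<epsilon> * cmod (z - w) * qnorm \<xi>)"
    if \<epsilon>: "0 < \<epsilon>" for \<epsilon>
  proof -
    obtain \<delta> where \<delta>: "0 < \<delta>" "\<And>z v. z \<in> U \<Longrightarrow> cmod (z - w) < \<delta> \<Longrightarrow>
        norm (F z v - F w v - pscale (z - w) (D w v)) \<le> \<epsilon> * cmod (z - w) * norm v"
      using diff[OF w \<epsilon>] by blast
    show ?thesis
    proof (intro exI[of _ \<delta>] conjI \<delta>(1) ballI impI, elim conjE imageE)
      fix z \<xi> v assume z: "z \<in> U" "0 < cmod (z - w)" "cmod (z - w) < \<delta>"
        and \<xi>: "\<xi> = qcls A v"
      let ?e = "\<lambda>v. F z v - F w v - pscale (z - w) (D w v)"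
      let ?N = "qnorm (qcls A (?e v))"
      \<comment> \<open>Dividing by the positive factor turns the estimate into a lower bound for
        all representatives, the form that \<open>qnorm_greatest\<close> needs.\<close>
      have "?N / (\<epsilon> * cmod (z - w)) \<le> norm u" if u: "u - v \<in> A" for u
      proof -
        have "F z u = F z v + F z (u - v)" "F w u = F w v + F w (u - v)" "D w u = D w v"
          using add[OF z(1), of v "u - v"] add[OF w, of v "u - v"] D(2)[OF u, of w v] by simp_all
        then have "?e u - ?e v = F z (u - v) - F w (u - v)"
          by (simp add: algebra_simps)
        also have "\<dots> \<in> A"
          using A[OF z(1) u] A[OF w u] by (rule psubspace_diff[OF sub])
        finally have "?N \<le> norm (?e u)"
          by (rule qnorm_le)
        also have "\<dots> \<le> \<epsilon> * cmod (z - w) * norm u"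
          by (rule \<delta>(2)[OF z(1,3)])
        finally show ?thesis
          using \<open>0 < \<epsilon>\<close> z(2) by (simp add: divide_le_eq mult.commute)
      qed
      then have "?N / (\<epsilon> * cmod (z - w)) \<le> qnorm (qcls A v)"
        by (rule qnorm_greatest)
      then have "?N \<le> \<epsilon> * cmod (z - w) * qnorm (qcls A v)"
        using \<open>0 < \<epsilon>\<close> z(2) by (simp add: divide_le_eq mult.commute)
      then show "qnorm (qdiff A (qdiff A (induced A (F z) \<xi>) (induced A (F w) \<xi>))
          (qscale A (z - w) (induced A (D w) \<xi>))) \<le> \<epsilon> * cmod (z - w) * qnorm \<xi>"
        by (simp only: \<xi> ind_D ind_F[OF z(1)] ind_F[OF w] qdiff_qcls qscale_qcls)
    qed
  qed
  moreover have "\<forall>\<xi>\<in>qcls A ` X. induced A (D w) \<xi> \<in> qspace A"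
    using D(1) by (simp add: induced_def qcls_in_qspace)
  ultimately show "\<exists>D. (\<forall>\<xi>\<in>qcls A ` X. D \<xi> \<in> qspace A) \<and> (\<forall>\<epsilon>>0. \<exists>\<delta>>0. \<forall>z\<in>U.
      0 < cmod (z - w) \<and> cmod (z - w) < \<delta> \<longrightarrow> (\<forall>\<xi>\<in>qcls A ` X.
        qnorm (qdiff A (qdiff A (induced A (F z) \<xi>) (induced A (F w) \<xi>))
          (qscale A (z - w) (D \<xi>))) \<le> \<epsilon> * cmod (z - w) * qnorm \<xi>))"
    by (intro exI[of _ "induced A (D w)"] conjI allI impI)
qed

end

section \<open>Holomorphic operator parameters for the two families\<close>

context contraction_pair
begin

lemma graph_map_A: "cmod z < 1 \<Longrightarrow> a \<in> A \<Longrightarrow> R.graph_map z a \<in> A"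
  using R.graph_map_eq_minus[OF _ fst_A] psubspace_uminus[OF sub] by simp

lemma holo_plus:
  "\<exists>C. (\<forall>z\<in>ball 0 1. qstrict_contraction A (qcls A ` graph_of S) (qcls A ` cograph_of R) qpos qneg (C z) \<and>
      qcls A ` Npos A z = {qadd A \<xi> (C z \<xi>) |\<xi>. \<xi> \<in> qcls A ` graph_of S}) \<and>
    qholo A (qcls A ` graph_of S) C (ball 0 1)"
proof (intro exI[of _ "\<lambda>z. induced A (R.graph_map z)"] conjI ballI)
  fix z :: complex assume "z \<in> ball 0 1"
  then have z: "cmod z < 1"
    by simp
  note F = R.graph_map_add[OF z] R.graph_map_pscale[OF z] graph_map_A[OF z]
  obtain k where "k < 1" "\<And>v. v \<in> graph_of S \<Longrightarrow>
      sqrt (- hform (R.graph_map z v)) \<le> k * sqrt (hform v)"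
    using hform_graph_map[OF z] by blast
  moreover have "qneg (qcls A (R.graph_map z v)) = - hform (R.graph_map z v)" for v
    using cograph_subset_sperp graph_map_in_cograph by (intro qneg_qcls) blast
  moreover have "qpos (qcls A v) = hform v" if "v \<in> graph_of S" for v
    using graph_subset_sperp that by (intro qpos_qcls) blast
  ultimately show "qstrict_contraction A (qcls A ` graph_of S) (qcls A ` cograph_of R) qpos qneg
      (induced A (R.graph_map z))"
    by (intro qstrict_contraction_induced F graph_map_in_cograph) auto
  show "qcls A ` Npos A z = {qadd A \<xi> (induced A (R.graph_map z) \<xi>) |\<xi>. \<xi> \<in> qcls A ` graph_of S}"
    unfolding Npos_eq_graph[OF z]
    unfolding Setcompr_eq_image image_image by (simp add: induced_qcls[OF F(1,3)] qadd_qcls)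
next
  show "qholo A (qcls A ` graph_of S) (\<lambda>z. induced A (R.graph_map z)) (ball 0 1)"
  proof (rule qholo_induced[where D = R.graph_map_deriv])
    show "R.graph_map_deriv z v \<in> sperp A" for z v
      using cograph_subset_sperp graph_map_deriv_in_cograph by blast
    show "R.graph_map_deriv z (v + a) = R.graph_map_deriv z v" if "a \<in> A" for z v a
      by (rule R.graph_map_deriv_cong[OF fst_A[OF that]])
    show "\<exists>\<delta>>0. \<forall>z\<in>ball 0 1. cmod (z - w) < \<delta> \<longrightarrow> (\<forall>v.
        norm (R.graph_map z v - R.graph_map w v - pscale (z - w) (R.graph_map_deriv w v))
          \<le> \<epsilon> * cmod (z - w) * norm v)"
      if "w \<in> ball 0 1" "0 < \<epsilon>" for w \<epsilon>
      using R.graph_map_complex_differentiable[of w \<epsilon>] that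
      by (metis dist_0_norm mem_ball)
  qed (simp_all add: R.graph_map_add graph_map_A)
qed

lemma holo_minus:
  "\<exists>D. (\<forall>z\<in>ball 0 1. qstrict_contraction A (qcls A ` cograph_of R) (qcls A ` graph_of S) qneg qpos (D z) \<and>
      qcls A ` Nneg A z = {qadd A (D z \<eta>) \<eta> |\<eta>. \<eta> \<in> qcls A ` cograph_of R}) \<and>
    qholo A (qcls A ` cograph_of R) D (ball 0 1)"
proof -
  interpret sw: contraction_pair "prod.swap ` A" R S c
    by (rule swap)
  \<comment> \<open>The quotient by \<open>A\<close> itself is kept; only the map built for the
    swapped pair is conjugated back. As \<open>swap\<close> negates \<open>hform\<close>, its
    contraction estimate becomes one from \<open>qneg\<close> to \<open>qpos\<close>.\<close>
  define F where "F z v = prod.swap (S.graph_map z (prod.swap v))" for z and v :: "'a \<times> 'a"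
  have swap_add: "prod.swap (v + w) = prod.swap v + prod.swap w"
    and swap_diff: "prod.swap (v - w) = prod.swap v - prod.swap w"
    and swap_pscale: "prod.swap (pscale d v) = pscale d (prod.swap v)"
    and norm_swap: "norm (prod.swap v) = norm v" for v w :: "'a \<times> 'a" and d
    by (simp_all add: prod_eq_iff norm_prod_def add.commute)
  have F_add: "F z (v + w) = F z v + F z w" and F_pscale: "F z (pscale d v) = pscale d (F z v)"
    if "cmod z < 1" for z v w d
    using that by (simp_all only: F_def swap_add swap_pscale S.graph_map_add S.graph_map_pscale)
  have F_A: "F z a \<in> A" if "cmod z < 1" "a \<in> A" for z a
    using sw.graph_map_A[OF that(1), of "prod.swap a"] that(2)
    by (simp only: F_def in_swap_image_iff swap_swap)
  have F_graph: "F z v \<in> graph_of S" for z v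
    using S.graph_map_mem[of z "prod.swap v"] by (simp add: F_def graph_of_def)
  show ?thesis
  proof (intro exI[of _ "\<lambda>z. induced A (F z)"] conjI ballI)
    fix z :: complex assume "z \<in> ball 0 1"
    then have z: "cmod z < 1"
      by simp
    obtain k where k: "k < 1" "\<And>v. v \<in> graph_of R \<Longrightarrow>
        sqrt (- hform (S.graph_map z v)) \<le> k * sqrt (hform v)"
      using sw.hform_graph_map[OF z] by blast
    have "sqrt (hform (F z v)) \<le> k * sqrt (- hform v)" if "v \<in> cograph_of R" for v
      using k(2)[of "prod.swap v"] that by (simp add: F_def graph_of_def cograph_of_def)
    moreover have "qpos (qcls A (F z v)) = hform (F z v)" for v
      using graph_subset_sperp F_graph by (intro qpos_qcls) blast
    moreover have "qneg (qcls A v) = - hform v" if "v \<in> cograph_of R" for v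
      using cograph_subset_sperp that by (intro qneg_qcls) blast
    ultimately show "qstrict_contraction A (qcls A ` cograph_of R) (qcls A ` graph_of S) qneg qpos
        (induced A (F z))"
      using k(1) by (intro qstrict_contraction_induced F_add F_pscale F_A F_graph z) auto
    have "Nneg A z = {F z v + v |v. v \<in> cograph_of R}"
    proof (rule set_eqI)
      fix u
      have "u \<in> Nneg A z \<longleftrightarrow> (\<exists>v. prod.swap u = v + S.graph_map z v \<and> v \<in> graph_of R)"
        unfolding Nneg_swap in_swap_image_iff sw.Npos_eq_graph[OF z] by blast
      also have "\<dots> \<longleftrightarrow> (\<exists>v. u = F z v + v \<and> v \<in> cograph_of R)"
        unfolding graph_of_swap in_swap_image_iff F_def
        by (metis add.commute swap_add swap_swap)
      finally show "u \<in> Nneg A z \<longleftrightarrow> u \<in> {F z v + v |v. v \<in> cograph_of R}"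
        by blast
    qed
    then show "qcls A ` Nneg A z = {qadd A (induced A (F z) \<eta>) \<eta> |\<eta>. \<eta> \<in> qcls A ` cograph_of R}"
      unfolding Setcompr_eq_image image_image
      by (simp add: induced_qcls[of "F z", OF F_add[OF z] F_A[OF z]] qadd_qcls image_image)
  next
    show "qholo A (qcls A ` cograph_of R) (\<lambda>z. induced A (F z)) (ball 0 1)"
    proof (rule qholo_induced[where D = "\<lambda>z v. prod.swap (S.graph_map_deriv z (prod.swap v))"])
      show "prod.swap (S.graph_map_deriv z (prod.swap v)) \<in> sperp A" for z v
        using S.graph_map_deriv_mem[of z "prod.swap v"] graph_subset_sperp
        by (auto simp: graph_of_def)
      show "prod.swap (S.graph_map_deriv z (prod.swap (v + a))) = prod.swap (S.graph_map_deriv z (prod.swap v))"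
        if "a \<in> A" for z v a
        using snd_A[OF that] by (simp add: swap_add S.graph_map_deriv_cong)
      show "\<exists>\<delta>>0. \<forall>z\<in>ball 0 1. cmod (z - w) < \<delta> \<longrightarrow> (\<forall>v.
          norm (F z v - F w v - pscale (z - w) (prod.swap (S.graph_map_deriv w (prod.swap v))))
            \<le> \<epsilon> * cmod (z - w) * norm v)"
        if w: "w \<in> ball 0 1" "0 < \<epsilon>" for w \<epsilon>
      proof -
        obtain \<delta> where \<delta>: "0 < \<delta>" "\<And>z v. cmod z < 1 \<Longrightarrow> cmod (z - w) < \<delta> \<Longrightarrow>
            norm (S.graph_map z v - S.graph_map w v - pscale (z - w) (S.graph_map_deriv w v))
              \<le> \<epsilon> * cmod (z - w) * norm v"
          using S.graph_map_complex_differentiable[of w \<epsilon>] w unfolding mem_ball dist_0_norm by blast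
        then have "norm (F z v - F w v - pscale (z - w) (prod.swap (S.graph_map_deriv w (prod.swap v))))
            \<le> \<epsilon> * cmod (z - w) * norm v" if "cmod z < 1" "cmod (z - w) < \<delta>" for z v
          using \<delta>(2)[OF that, of "prod.swap v"]
          by (simp only: F_def swap_diff[symmetric] swap_pscale[symmetric] norm_swap)
        then show ?thesis
          using \<delta>(1) by auto
      qed
    qed (simp_all add: F_add F_A)
  qed
qed

end

section \<open>Maximal positive subspaces as graphs\<close>

context isotropic
begin

text \<open>If the first coordinates miss some direction, a vector \<open>y\<close> orthogonal to
  all of them exists, and adjoining \<open>(y, 0)\<close> keeps the subspace positive, since this
  vector is positive and symplectically orthogonal to \<open>M\<close>. That contradicts
  maximality.\<close>

lemma positive_maximal_surj:
  assumes M: "psubspace M" "closed M" "A \<subseteq> M" "M \<subseteq> sperp A"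
    and L: "qcls A ` M \<in> Wplus A"
  shows "fst ` M = UNIV"
proof (rule ccontr)
  assume "fst ` M \<noteq> UNIV"
  then obtain x where x: "x \<notin> fst ` M"
    by blast
  have pos: "0 < hform v" if "v \<in> M" "v \<notin> A" for v
  proof -
    have "qcls A v \<noteq> A" "v \<in> sperp A"
      using that M(4) by (auto simp: qcls_eq_A_iff)
    then show ?thesis
      using L that(1) by (auto simp: Wplus_def qpos_qcls)
  qed
  have nonneg: "0 \<le> hform v" if "v \<in> M" for v
  proof (cases "v \<in> A")
    case True
    then show ?thesis
      using norm_fst_eq_norm_snd[of v] by (simp add: hform_def)
  next
    case False
    then show ?thesis
      using pos[OF that] by simp
  qed
  have "csubspace (fst ` M)"
    unfolding csubspace_def
  proof (intro conjI ballI allI)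
    show "0 \<in> fst ` M"
      using psubspace_0[OF M(1)] by (intro image_eqI[of _ _ 0]) auto
    show "a + b \<in> fst ` M" if "a \<in> fst ` M" "b \<in> fst ` M" for a b
      using that psubspace_add[OF M(1)] by (elim imageE) (metis fst_add imageI)
    show "cscale d a \<in> fst ` M" if "a \<in> fst ` M" for d a
      using that psubspace_pscale[OF M(1)] by (elim imageE) (metis fst_pscale imageI)
  qed
  \<comment> \<open>Nonnegativity of the form bounds the second coordinate by the first, so
    \<open>fst\<close> is bounded below on \<open>M\<close> and its image is complete.\<close>
  moreover have "complete (fst ` M)"
  proof (rule complete_isometric_image[of "1/2"])
    show "\<forall>v\<in>M. 1 / 2 * norm v \<le> norm (fst v)"
    proof
      fix v assume "v \<in> M"
      then have "(norm (snd v))\<^sup>2 \<le> (norm (fst v))\<^sup>2"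
        using nonneg[of v] by (simp add: hform_def)
      then have "norm (snd v) \<le> norm (fst v)"
        by (rule power2_le_imp_le) simp
      then show "1 / 2 * norm v \<le> norm (fst v)"
        using norm_Pair_le[of "fst v" "snd v"] by simp
    qed
  qed (use M in \<open>auto simp: psubspace_imp_subspace complete_eq_closed bounded_linear_fst\<close>)
  ultimately obtain e where e: "e \<in> fst ` M" "\<And>u. u \<in> fst ` M \<Longrightarrow> cinner (x - e) u = 0"
    using orthogonal_projection complete_imp_closed by blast
  define y where "y = x - e"
  have y0: "y \<noteq> 0"
    using e(1) x by (auto simp: y_def)
  have y: "cinner (fst v) y = 0" if "v \<in> M" for v
    using e(2)[of "fst v"] that cinner_eq_0_commute by (auto simp: y_def)
  have y_sperp: "(y, 0) \<in> sperp A"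
    using y M(3) by (auto simp: sperp_def symp_def cinner_eq_0_commute[of y])
  \<comment> \<open>\<open>p\<close> removes the component along \<open>(y, 0)\<close>. Writing the
    enlarged space \<open>M'\<close> as a preimage under this continuous linear map gives its
    closedness at once.\<close>
  define p where "p v = v - pscale (cinner (fst v) y / (norm y)\<^sup>2) (y, 0)" for v :: "'a \<times> 'a"
  define M' where "M' = {v. p v \<in> M}"
  have p_add: "p (v + w) = p v + p w" and p_pscale: "p (pscale d v) = pscale d (p v)" for v w d
    by (simp_all add: p_def prod_eq_iff cinner_simps cscale_simps add_divide_distrib algebra_simps)
  have p_M: "p v = v" if "v \<in> M" for v
    using y[OF that] by (simp add: p_def)
  have M': "psubspace M'"
    using M(1) p_M[OF psubspace_0[OF M(1)]]
    by (simp add: psubspace_def M'_def p_add p_pscale)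
  have "closed M'"
  proof -
    have "continuous_on UNIV p"
      unfolding p_def pscale_def by (intro continuous_intros) (use y0 in auto)
    then have "closed (p -` M)"
      using M(2) by (simp add: closed_vimage continuous_on_eq_continuous_at)
    then show ?thesis
      by (simp add: M'_def vimage_def)
  qed
  have "M \<subseteq> M'"
    using p_M by (auto simp: M'_def)
  have M'_sperp: "v \<in> sperp A" if "v \<in> M'" for v
  proof -
    have "p v \<in> sperp A"
      using that M(4) by (auto simp: M'_def)
    from psubspace_add[OF psubspace_sperp this psubspace_pscale[OF psubspace_sperp y_sperp]]
    have "p v + pscale (cinner (fst v) y / (norm y)\<^sup>2) (y, 0) \<in> sperp A" .
    then show ?thesis
      by (simp add: p_def)
  qed
  have pos': "0 < hform v" if v: "v \<in> M'" "v \<notin> A" for v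
  proof -
    define t where "t = cinner (fst v) y / (norm y)\<^sup>2"
    have pv: "p v \<in> M" and v_eq: "v = p v + pscale t (y, 0)"
      using v(1) by (simp_all add: M'_def p_def t_def)
    have "symp (p v) (pscale t (y, 0)) = 0"
      using y[OF pv] by (simp add: symp_def cinner_simps)
    then have h: "hform v = hform (p v) + (cmod t)\<^sup>2 * (norm y)\<^sup>2"
      using hform_add[of "p v" "pscale t (y, 0)"] v_eq hform_pscale[of t "(y, 0)"]
      by (simp add: hform_def)
    show ?thesis
    proof (cases "t = 0")
      case True
      then show ?thesis
        using pos[of v] pv v(2) v_eq by simp
    next
      case False
      then show ?thesis
        using nonneg[OF pv] y0 by (simp add: h add_nonneg_pos)
    qed
  qed
  have "qsubspace A (qcls A ` M')" "qclosed A (qcls A ` M')"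
    using M'_sperp \<open>M \<subseteq> M'\<close> M(3) by (auto intro!: qsubspace_image qclosed_image M' \<open>closed M'\<close>)
  moreover have "\<forall>\<xi>\<in>qcls A ` M'. \<xi> \<noteq> A \<longrightarrow> 0 < qpos \<xi>"
    using pos' M'_sperp by (auto simp: qpos_qcls qcls_eq_A_iff)
  moreover have "qcls A ` M \<subseteq> qcls A ` M'"
    using \<open>M \<subseteq> M'\<close> by (rule image_mono)
  moreover have "\<forall>L'. qsubspace A L' \<and> qclosed A L' \<and> (\<forall>\<xi>\<in>L'. \<xi> \<noteq> A \<longrightarrow> 0 < qpos \<xi>) \<and>
      qcls A ` M \<subseteq> L' \<longrightarrow> L' = qcls A ` M"
    using L unfolding Wplus_def by (elim CollectE conjE)
  ultimately have "qcls A ` M' = qcls A ` M"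
    by (elim allE[of _ "qcls A ` M'"]) (simp only: simp_thms)
  moreover have "p (y, 0) = 0"
    using y0 by (simp add: p_def prod_eq_iff cinner_norm cscale_one)
  then have "(y, 0) \<in> M'"
    using psubspace_0[OF M(1)] by (simp add: M'_def)
  ultimately have "(y, 0) \<in> M"
    using qcls_in_image_iff[OF M(1,3)] by blast
  then show False
    using y[of "(y, 0)"] y0 by simp
qed

text \<open>Surjectivity onto first coordinates provides S, nonnegativity of the form makes it
  single-valued and contractive, and pairing with all \<open>(y, S y)\<close> identifies the
  complement through the adjoint.\<close>

lemma Wplus_graph:
  assumes L: "L \<in> Wplus A"
  obtains S R c where "contraction_pair A S R c" "L = qcls A ` graph_of S"
    "qperp A L = qcls A ` cograph_of R"
proof -
  have "qsubspace A L" "qclosed A L"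
    using L by (simp_all add: Wplus_def)
  then obtain M where M: "psubspace M" "closed M" "A \<subseteq> M" "M \<subseteq> sperp A" and L_eq: "L = qcls A ` M"
    by (rule qclosed_subspace_lift)
  have qpos_M: "qpos (qcls A v) = hform v" if "v \<in> M" for v
    using that M(4) by (auto simp: qpos_qcls)
  obtain c0 where c0: "0 < c0" "\<And>v. v \<in> M \<Longrightarrow> c0 * (qnorm (qcls A v))\<^sup>2 \<le> hform v"
    using L qpos_M by (auto simp: Wplus_def L_eq)
  have nonneg: "0 \<le> hform v" if "v \<in> M" for v
    using c0(2)[OF that] c0(1) by (meson mult_nonneg_nonneg less_imp_le order_trans zero_le_power2)
  have "y \<in> fst ` M" for y
    using positive_maximal_surj[OF M] L by (simp add: L_eq)
  then have "\<forall>y. \<exists>b. (y, b) \<in> M"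
    by force
  then obtain S where S: "\<And>y. (y, S y) \<in> M"
    by metis
  \<comment> \<open>The difference has first coordinate zero, so its form is minus the squared norm
    of the second, which must vanish.\<close>
  have S_unique: "snd v = S (fst v)" if "v \<in> M" for v
  proof -
    have "v - (fst v, S (fst v)) \<in> M"
      using psubspace_diff[OF M(1) that S] .
    from nonneg[OF this] show ?thesis
      by (simp add: hform_def)
  qed
  have graph: "M = graph_of S"
  proof
    show "M \<subseteq> graph_of S"
      using S_unique by (auto simp: graph_of_def)
    show "graph_of S \<subseteq> M"
      using S by (auto simp: graph_of_def)
  qed
  have S_lin: "clinear S"
    unfolding clinear_def
  proof (intro conjI allI)
    show "S (x + y) = S x + S y" for x y
      using S_unique[OF psubspace_add[OF M(1) S S], of x y] by simp
    show "S (cscale d x) = cscale d (S x)" for d x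
      using S_unique[OF psubspace_pscale[OF M(1) S], of d x] by simp
  qed
  have S_norm: "norm (S x) \<le> norm x" for x
    by (rule power2_le_imp_le) (use nonneg[OF S[of x]] in \<open>simp_all add: hform_def\<close>)
  define R where "R = cadjoint S"
  have "bounded_clinear S"
    unfolding bounded_clinear_def using S_lin S_norm by (metis mult.right_neutral)
  then have adj: "cinner (S x) y = cinner x (R y)" for x y
    unfolding R_def by (rule cinner_cadjoint)
  have R_lin: "clinear R"
    unfolding clinear_def
    by (intro conjI allI cinner_ext) (simp_all add: cinner_simps flip: adj)
  have R_norm: "norm (R y) \<le> norm y" for y
  proof -
    have "(norm (R y))\<^sup>2 = cmod (cinner (S (R y)) y)"
      by (simp add: adj cinner_norm norm_power)
    also have "\<dots> \<le> norm (R y) * norm y"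
      using cinner_Cauchy_Schwarz[of "S (R y)" y] mult_right_mono[OF S_norm, of "norm y" "R y"]
      by simp
    finally show ?thesis
      by (cases "R y = 0") (auto simp: power2_eq_square)
  qed
  \<comment> \<open>Lowering \<open>c0\<close> to at most 1/2 ensures c < 1, as the locale
    demands.\<close>
  define c where "c = min c0 (1 / 2)"
  show thesis
  proof (rule that[of S R c])
    show "contraction_pair A S R c"
    proof
      show "A \<subseteq> graph_of S"
        using M(3) graph by simp
      show "A \<subseteq> cograph_of R"
      proof
        fix a assume a: "a \<in> A"
        have "cinner y (fst a) = cinner y (R (snd a))" for y
          using symp_A[OF _ a, of "(y, S y)"] S[of y] M(4) by (auto simp: symp_eq_0_iff adj)
        then show "a \<in> cograph_of R"
          unfolding cograph_of_def by (blast intro: cinner_ext)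
      qed
      show "(norm (S y))\<^sup>2 \<le> (1 - c) * (norm y)\<^sup>2"
        if y: "\<And>a. a \<in> A \<Longrightarrow> cinner y (fst a) = 0" for y
      proof -
        \<comment> \<open>Adding an element of \<open>A\<close> adds to \<open>y\<close> something
          orthogonal to it, so no representative is shorter than \<open>y\<close>. This converts the
          bound in the quotient norm into one in the norm of H.\<close>
        have "norm y \<le> norm w" if w: "w - (y, S y) \<in> A" for w
        proof -
          have "(norm y)\<^sup>2 \<le> (norm (y + fst (w - (y, S y))))\<^sup>2"
            using y[OF w] by (simp only: norm_add_sq) simp
          then have "norm y \<le> norm (y + fst (w - (y, S y)))"
            by (rule power2_le_imp_le) simp
          also have "\<dots> \<le> norm w"
            using norm_fst_le[of "fst w" "snd w"] by simp
          finally show ?thesis .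
        qed
        then have "norm y \<le> qnorm (qcls A (y, S y))"
          by (rule qnorm_greatest)
        then have "c * (norm y)\<^sup>2 \<le> c0 * (qnorm (qcls A (y, S y)))\<^sup>2"
          using c0(1) by (intro mult_mono power_mono) (auto simp: c_def)
        also have "\<dots> \<le> hform (y, S y)"
          by (rule c0(2)[OF S])
        finally show ?thesis
          by (simp add: hform_def algebra_simps)
      qed
    qed (use S_lin R_lin S_norm R_norm adj c0(1) in \<open>auto simp: c_def\<close>)
    then interpret contraction_pair A S R c .
    show "L = qcls A ` graph_of S"
      by (simp add: L_eq graph)
    show "qperp A L = qcls A ` cograph_of R"
    proof
      show "qcls A ` cograph_of R \<subseteq> qperp A L"
      proof
        fix \<eta> assume "\<eta> \<in> qcls A ` cograph_of R"
        then obtain m where m: "m \<in> cograph_of R" "\<eta> = qcls A m"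
          by blast
        then have "m \<in> sperp A"
          using cograph_subset_sperp by blast
        moreover have "symp m v = 0" if "v \<in> graph_of S" for v
          using symp_graph_cograph[OF that m(1)] by (simp only: symp_eq_0_commute[of m])
        ultimately show "\<eta> \<in> qperp A L"
          using graph_subset_sperp
          by (auto simp: qperp_def m(2) L_eq graph qcls_in_qspace qsymp_qcls)
      qed
      show "qperp A L \<subseteq> qcls A ` cograph_of R"
      proof
        fix \<eta> assume \<eta>: "\<eta> \<in> qperp A L"
        then obtain v where v: "v \<in> sperp A" "\<eta> = qcls A v"
          by (auto simp: qperp_def qspace_def)
        have "cinner y (fst v) = cinner y (R (snd v))" for y
        proof -
          have "(y, S y) \<in> sperp A"
            using S M(4) by blast
          then have "symp v (y, S y) = 0"
            using \<eta> S[of y] v by (auto simp: qperp_def L_eq qsymp_qcls)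
          then have "symp (y, S y) v = 0"
            by (simp only: symp_eq_0_commute[of v])
          then show ?thesis
            by (simp add: symp_eq_0_iff adj)
        qed
        then have "v \<in> cograph_of R"
          unfolding cograph_of_def by (blast intro: cinner_ext)
        then show "\<eta> \<in> qcls A ` cograph_of R"
          using v(2) by blast
      qed
    qed
  qed
qed

section \<open>Holomorphy at an arbitrary base point, and the case of \<open>AT T\<close>\<close>

lemma holo_Wplus_Npos: "holo_Wplus A (\<lambda>z. qcls A ` Npos A z) (ball 0 1)"
  unfolding holo_Wplus_def
proof
  fix L assume "L \<in> Wplus A"
  then obtain S R c where "contraction_pair A S R c" "L = qcls A ` graph_of S"
    "qperp A L = qcls A ` cograph_of R"
    by (rule Wplus_graph)
  then show "\<exists>C. (\<forall>z\<in>ball 0 1. qstrict_contraction A L (qperp A L) qpos qneg (C z) \<and>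
      qcls A ` Npos A z = {qadd A \<xi> (C z \<xi>) |\<xi>. \<xi> \<in> L}) \<and> qholo A L C (ball 0 1)"
    using contraction_pair.holo_plus by simp
qed

lemma holo_Wminus_Nneg: "holo_Wminus A (\<lambda>z. qcls A ` Nneg A z) (ball 0 1)"
  unfolding holo_Wminus_def
proof
  fix L assume "L \<in> Wplus A"
  then obtain S R c where "contraction_pair A S R c" "L = qcls A ` graph_of S"
    "qperp A L = qcls A ` cograph_of R"
    by (rule Wplus_graph)
  then show "\<exists>D. (\<forall>z\<in>ball 0 1. qstrict_contraction A (qperp A L) L qneg qpos (D z) \<and>
      qcls A ` Nneg A z = {qadd A (D z \<eta>) \<eta> |\<eta>. \<eta> \<in> qperp A L}) \<and> qholo A (qperp A L) D (ball 0 1)"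
    using contraction_pair.holo_minus by simp
qed

end

text \<open>Testing the equation defining \<open>defectK\<close> against all vectors replaces the
  adjoint by equalities of inner products. In this form the subspace is an intersection of closed
  conditions, and isotropy is one of its instances.\<close>

lemma isotropic_AT:
  fixes T :: "'a::chilbert \<Rightarrow> 'a"
  assumes T: "bounded_clinear T"
  shows "isotropic (AT T)"
proof
  have lin: "clinear T"
    using T by (simp add: bounded_clinear_def)
  have adj: "cinner (T x) y = cinner x (cadjoint T y)" for x y
    using T by (rule cinner_cadjoint)
  have defect: "x \<in> defectK T \<longleftrightarrow> (\<forall>u. cinner (T u) (T x) = cinner u x)" for x
    unfolding defectK_def adj by (auto intro: cinner_ext)
  have AT: "v \<in> AT T \<longleftrightarrow> snd v = T (fst v) \<and> (\<forall>u. cinner (T u) (snd v) = cinner u (fst v))" for v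
    by (cases v) (auto simp: AT_def defect)
  show "psubspace (AT T)"
    unfolding psubspace_def by (auto simp: AT clinear_simps[OF lin] cinner_simps)
  have bl: "bounded_linear T"
    using T by (rule bounded_clinear_imp_bounded_linear)
  have "AT T = {v. snd v = T (fst v)} \<inter> (\<Inter>u. {v. cinner (T u) (snd v) = cinner u (fst v)})"
    by (auto simp: AT)
  moreover have "closed {v. snd v = T (fst v)}"
    by (intro closed_Collect_eq continuous_intros bounded_linear.continuous_on[OF bl])
  ultimately show "closed (AT T)"
    by (auto intro!: closed_Int closed_INT closed_Collect_eq continuous_intros)
  show "AT T \<subseteq> sperp (AT T)"
    by (auto simp: sperp_def AT symp_eq_0_iff)
qed

theorem theorem4p5:
  fixes T :: "'h::chilbert \<Rightarrow> 'h"
  assumes inf_dim: "\<forall>S::'h set. finite S \<longrightarrow> cspan S \<noteq> UNIV"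
    and separable: "separable_space (euclidean :: 'h topology)"
    and bounded: "bounded_clinear T"
    and contraction: "\<forall>x. norm (T x) \<le> norm x"
    and cnu: "cnu T"
  shows "(\<forall>z\<in>ball 0 1. WTplus T z \<in> Wplus (AT T))
       \<and> (\<forall>z\<in>ball 0 1. WTminus T z \<in> Wminus (AT T))
       \<and> holo_Wplus (AT T) (WTplus T) (ball 0 1)
       \<and> holo_Wminus (AT T) (WTminus T) (ball 0 1)
       \<and> (\<forall>z\<in>ball 0 1. WTminus T (cnj z) = qperp (AT T) (WTplus T z))"
proof -
  interpret isotropic "AT T"
    using bounded by (rule isotropic_AT)
  have "WTplus T = (\<lambda>z. qcls (AT T) ` Npos (AT T) z)" "WTminus T = (\<lambda>z. qcls (AT T) ` Nneg (AT T) z)"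
    by (simp_all add: fun_eq_iff WTplus_def WTminus_def Nplus_def Nminus_def Npos_def Nneg_def)
  then show ?thesis
    using Npos_in_Wplus Nneg_in_Wminus qperp_Npos holo_Wplus_Npos holo_Wminus_Nneg by simp
qed

end
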